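(* Let $K\ge1$, $s\ge0$, $1\le R_1,R_2\le K$, and let $\Delta=(\mathbf w,\mathcal R_1,\phi)$ be an admissible substructure. Then the number of arrowed arrays in $\mathrm{AR}(K,R_1,R_2,s)$ belonging to $\Delta$ is \[ T(\Delta)=s!\sum_{A=0}^{s-1}\frac{r}{s-A}\binom{M}{M-A}\binom{K-M-1}{R_2-M+A-1}, \] where $r=\sum_{j\in\mathcal R_1}w_j$ and $M$ is the number of columns containing a critical vertex in row 1.
   Context: Two-row vertical arrays: for $K\ge1$, $s\ge0$, $1\le R_1,R_2\le K$, such an array is a $2\times K$ grid of cells, each cell containing a possibly empty left-to-right ordered list of unlabelled vertices, each row containing $s$ vertices, the vertices partitioned into $s$ pairs each consisting of one vertex of row 1 and one of row 2 (partners), with exactly $R_1$ marked cells in row 1 and $R_2$ in row 2. Arrays are equal if they have the same vertex counts per cell, marked cells and pairing of vertex positions. Arrowed array: a pair $(\alpha,\phi)$ where $\alpha$ is such an array and $\phi$ is a function from a subset $\mathcal H\subseteq\{1,\dots,K\}\setminus\mathcal R_1$ to $\{1,\dots,K\}$, $\mathcal R_1$ being the set of marked columns of row 1 (column $j\in\mathcal H$ has an arrow-tail; $\phi(j)$ holds an arrow-head). A vertex is critical if it is the rightmost vertex of its cell and that cell is neither marked nor a row-1 cell $(1,j)$ with $j\in\mathcal H$. Forest condition: let $\mathcal F_i$ be the set of columns whose row-$i$ cell is nonempty and $\mathcal R_2$ the marked columns of row 2; define $\psi_1$ on $(\mathcal H\cup\mathcal F_1)\setminus\mathcal R_1$ by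 $\psi_1(j)=\phi(j)$ for $j\in\mathcal H$ and, for $j\in\mathcal F_1\setminus(\mathcal H\cup\mathcal R_1)$, $\psi_1(j)=$ the column of the partner of the rightmost vertex of cell $(1,j)$; define $\psi_2$ on $\mathcal F_2\setminus\mathcal R_2$ by $\psi_2(j)=$ the column of the partner of the rightmost vertex of cell $(2,j)$. The forest condition holds if for $i=1,2$ every $j$ in the domain of $\psi_i$ has some $t\ge1$ with $\psi_i^t(j)$ defined and in $\mathcal R_i$. $\mathrm{AR}(K,R_1,R_2,s)$ is the set of arrowed arrays satisfying the forest condition. Substructure $\Delta$: given $\mathbf w=(w_1,\dots,w_K)$ non-negative integers with $\sum_jw_j=s$, an $R_1$-subset $\mathcal R_1$ of columns, and $\phi$ a function from $\mathcal H\subseteq\{1,\dots,K\}\setminus\mathcal R_1$ to $\{1,\dots,K\}$, $\Delta=(\mathbf w,\mathcal R_1,\phi)$ is the set of $(\alpha,\phi')\in\mathrm{AR}(K,R_1,R_2,s)$ with $\phi'=\phi$, row-1 marked set $\mathcal R_1$, and both cells $(1,j),(2,j)$ containing exactly $w_j$ vertices for every $j$; $T(\Delta)$ is its cardinality. $\Delta$ is irreducible if the functional digraph of $\phi$ is acyclic and $\phi(j)\notin\mathcal R_1\cup\mathcal H$ for all $j\in\mathcal H$; it is admissible if it is irreducible and $w_{\phi(j)}\ge1$ for every $j\in\mathcal H$. (The columns containing a critical vertex in row 1 are those $j\notin\mathcal R_1\cup\mathcal H$ with $w_j\ge1$.) Binomial coefficients $\binom{a}{b}$ with $b<0$ or $b>a$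 are $0$.
   Formalization: The formal theorem assumes s ≥ 1 instead of s ≥ 0: for s = 0 the stated formula always fails, since the sum is empty and equals 0 while T(Δ) = binom(K, R_2) ≥ 1 (e.g. K = R_1 = R_2 = 1 gives T(Δ) = 1). *)

theory Defs
  imports Complex_Main
begin

datatype row = Row1 | Row2

text \<open>
  Columns are numbered \<open>1..K\<close>, and the vertex \<open>(j, p)\<close> of a row is the \<open>p\<close>-th vertex from the
  left (counting from 1) of the cell in column \<open>j\<close>.  As vertices are unlabelled, an array is
  determined by its cell sizes, its marked cells and the pairing of vertex positions.  A pair
  \<open>(u, v)\<close> in \<open>pairing\<close> consists of a vertex \<open>u\<close> of row 1 and a vertex \<open>v\<close> of row 2.
\<close>

type_synonym vertex = "nat \<times> nat"

record varray =
  cnt :: "row \<Rightarrow> nat \<Rightarrow> nat"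
  mark :: "row \<Rightarrow> nat set"
  pairing :: "(vertex \<times> vertex) set"

type_synonym arrowed = "varray \<times> (nat \<rightharpoonup> nat)"

definition vertices :: "nat \<Rightarrow> varray \<Rightarrow> row \<Rightarrow> vertex set" where
  "vertices K \<alpha> i = {(j, p). j \<in> {1..K} \<and> p \<in> {1..cnt \<alpha> i j}}"

text \<open>The cell sizes are required to vanish outside the grid, so that record equality
  is equality of arrays.\<close>

definition is_varray :: "nat \<Rightarrow> nat \<Rightarrow> nat \<Rightarrow> nat \<Rightarrow> varray \<Rightarrow> bool" where
  "is_varray K R1 R2 s \<alpha> \<longleftrightarrow>
     (\<forall>i j. j \<notin> {1..K} \<longrightarrow> cnt \<alpha> i j = 0) \<and>
     (\<forall>i. (\<Sum>j=1..K. cnt \<alpha> i j) = s) \<and>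
     (\<forall>i. mark \<alpha> i \<subseteq> {1..K}) \<and>
     card (mark \<alpha> Row1) = R1 \<and> card (mark \<alpha> Row2) = R2 \<and>
     pairing \<alpha> \<subseteq> vertices K \<alpha> Row1 \<times> vertices K \<alpha> Row2 \<and>
     (\<forall>u\<in>vertices K \<alpha> Row1. \<exists>!v. (u, v) \<in> pairing \<alpha>) \<and>
     (\<forall>v\<in>vertices K \<alpha> Row2. \<exists>!u. (u, v) \<in> pairing \<alpha>)"

fun partner :: "varray \<Rightarrow> row \<Rightarrow> vertex \<Rightarrow> vertex" where
  "partner \<alpha> Row1 u = (THE v. (u, v) \<in> pairing \<alpha>)"
| "partner \<alpha> Row2 v = (THE u. (u, v) \<in> pairing \<alpha>)"

definition rightmost :: "varray \<Rightarrow> row \<Rightarrow> nat \<Rightarrow> vertex" where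
  "rightmost \<alpha> i j = (j, cnt \<alpha> i j)"

definition nonempty_cols :: "varray \<Rightarrow> row \<Rightarrow> nat set" where
  "nonempty_cols \<alpha> i = {j. cnt \<alpha> i j > 0}"

fun critical :: "nat \<Rightarrow> arrowed \<Rightarrow> row \<Rightarrow> vertex \<Rightarrow> bool" where
  "critical K (\<alpha>, \<phi>) i (j, p) \<longleftrightarrow>
     (j, p) \<in> vertices K \<alpha> i \<and> (j, p) = rightmost \<alpha> i j \<and>
     j \<notin> mark \<alpha> i \<and> \<not> (i = Row1 \<and> j \<in> dom \<phi>)"

fun psi :: "arrowed \<Rightarrow> row \<Rightarrow> nat \<rightharpoonup> nat" where
  "psi (\<alpha>, \<phi>) Row1 j =
     (if j \<in> (dom \<phi> \<union> nonempty_cols \<alpha> Row1) - mark \<alpha> Row1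
      then (if j \<in> dom \<phi> then \<phi> j
            else Some (fst (partner \<alpha> Row1 (rightmost \<alpha> Row1 j))))
      else None)"
| "psi (\<alpha>, \<phi>) Row2 j =
     (if j \<in> nonempty_cols \<alpha> Row2 - mark \<alpha> Row2
      then Some (fst (partner \<alpha> Row2 (rightmost \<alpha> Row2 j)))
      else None)"

text \<open>Iterates of a partial function are taken as relational powers of its graph:
  \<open>(j, k) \<in> Map.graph f ^^ t\<close> means that the \<open>t\<close>-th iterate of \<open>f\<close> at \<open>j\<close> is defined and equals \<open>k\<close>.\<close>

definition forest_condition :: "arrowed \<Rightarrow> bool" where
  "forest_condition a \<longleftrightarrow>
     (\<forall>i. \<forall>j\<in>dom (psi a i). \<exists>t\<ge>1. \<exists>k\<in>mark (fst a) i. (j, k) \<in> Map.graph (psi a i) ^^ t)"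

definition AR :: "nat \<Rightarrow> nat \<Rightarrow> nat \<Rightarrow> nat \<Rightarrow> arrowed set" where
  "AR K R1 R2 s =
     {(\<alpha>, \<phi>). is_varray K R1 R2 s \<alpha> \<and>
        dom \<phi> \<subseteq> {1..K} - mark \<alpha> Row1 \<and> ran \<phi> \<subseteq> {1..K} \<and>
        forest_condition (\<alpha>, \<phi>)}"

text \<open>Only the values of \<open>w\<close> on \<open>{1..K}\<close> are relevant.\<close>

definition substructure_data ::
  "nat \<Rightarrow> nat \<Rightarrow> nat \<Rightarrow> (nat \<Rightarrow> nat) \<Rightarrow> nat set \<Rightarrow> (nat \<rightharpoonup> nat) \<Rightarrow> bool" where
  "substructure_data K R1 s w \<R> \<phi> \<longleftrightarrow>
     (\<Sum>j=1..K. w j) = s \<and> \<R> \<subseteq> {1..K} \<and> card \<R> = R1 \<and>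
     dom \<phi> \<subseteq> {1..K} - \<R> \<and> ran \<phi> \<subseteq> {1..K}"

definition substructure ::
  "nat \<Rightarrow> nat \<Rightarrow> nat \<Rightarrow> nat \<Rightarrow> (nat \<Rightarrow> nat) \<Rightarrow> nat set \<Rightarrow> (nat \<rightharpoonup> nat) \<Rightarrow> arrowed set" where
  "substructure K R1 R2 s w \<R> \<phi> =
     {(\<alpha>, \<phi>'). (\<alpha>, \<phi>') \<in> AR K R1 R2 s \<and> \<phi>' = \<phi> \<and> mark \<alpha> Row1 = \<R> \<and>
        (\<forall>i. \<forall>j\<in>{1..K}. cnt \<alpha> i j = w j)}"

definition irreducible_sub :: "nat set \<Rightarrow> (nat \<rightharpoonup> nat) \<Rightarrow> bool" where
  "irreducible_sub \<R> \<phi> \<longleftrightarrow>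
     acyclic (Map.graph \<phi>) \<and> (\<forall>j\<in>dom \<phi>. the (\<phi> j) \<notin> \<R> \<union> dom \<phi>)"

definition admissible_sub :: "(nat \<Rightarrow> nat) \<Rightarrow> nat set \<Rightarrow> (nat \<rightharpoonup> nat) \<Rightarrow> bool" where
  "admissible_sub w \<R> \<phi> \<longleftrightarrow>
     irreducible_sub \<R> \<phi> \<and> (\<forall>j\<in>dom \<phi>. w (the (\<phi> j)) \<ge> 1)"

definition critical_cols ::
  "nat \<Rightarrow> (nat \<Rightarrow> nat) \<Rightarrow> nat set \<Rightarrow> (nat \<rightharpoonup> nat) \<Rightarrow> nat set" where
  "critical_cols K w \<R> \<phi> = {j \<in> {1..K}. j \<notin> \<R> \<union> dom \<phi> \<and> w j \<ge> 1}"

text \<open>The columns with a critical vertex in row 1 depend only on the substructure:\<close>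

lemma critical_cols_substructure:
  assumes "a \<in> substructure K R1 R2 s w \<R> \<phi>"
  shows "fst ` {v. critical K a Row1 v} = critical_cols K w \<R> \<phi>"
proof -
  obtain \<alpha> where a: "a = (\<alpha>, \<phi>)" "mark \<alpha> Row1 = \<R>" "\<forall>j\<in>{1..K}. cnt \<alpha> Row1 j = w j"
    using assms by (auto simp: substructure_def)
  then show ?thesis
    by (force simp: critical_cols_def vertices_def rightmost_def image_iff)
qed

text \<open>Binomial coefficients with integer arguments, zero unless \<open>0 \<le> b \<le> a\<close>.\<close>

definition binom :: "int \<Rightarrow> int \<Rightarrow> nat" where
  "binom a b = (if b < 0 \<or> b > a then 0 else nat a choose nat b)"

end

theory Submission
  imports Defs
begin

text \<open>
  An array in the substructure is a perfect matching \<open>\<sigma>\<close> of the two rows together with the set \<open>P\<close>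
  of marked columns of row 2.  First fix only the part \<open>h\<close> of \<open>\<sigma>\<close> at the \<open>M\<close> critical vertices of
  row 1, chosen such that the first forest condition holds.  Then \<open>h\<close> forces some edges of the
  digraph of \<open>\<psi>\<^sub>2\<close>, and they form paths; the number of completions of \<open>h\<close> satisfying the second
  forest condition is \<open>(s - M - 1)!\<close> times the number of free vertices \<open>u\<close> of row 1 whose forced
  path meets \<open>P\<close>.  Summed over \<open>P\<close>, a path with \<open>l\<close> columns contributes
  \<open>\<Sum>m<l. (K - m - 1 choose R\<^sub>2 - 1)\<close>, so one has to count triples of a core \<open>h\<close>, a vertex \<open>u\<close> and
  a forced path with \<open>m\<close> edges from the column of \<open>u\<close>.  For fixed critical columns on the path,
  the same counting principle applied to row 1, summed over \<open>u\<close>, gives a number depending on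
  \<open>m\<close> only, and \<open>T(\<Delta>) = r \<Sum>m\<le>M. (K - m - 1 choose R\<^sub>2 - 1) M! / (M - m)! (s - m - 1)!\<close>.
  Vandermonde's identity and the hockey-stick identity turn this into the stated sum.
\<close>

section \<open>Perfect matchings with an acyclic digraph\<close>

text \<open>Relations instead of functions: \<open>converse\<close> exchanges the two rows, and
  pairs can be fixed one at a time.\<close>

definition partial_matching :: "'u set \<Rightarrow> 'x set \<Rightarrow> ('u \<times> 'x) set \<Rightarrow> bool" where
  "partial_matching U X h \<longleftrightarrow>
     single_valued h \<and> single_valued (h\<inverse>) \<and> Domain h \<subseteq> U \<and> Range h \<subseteq> X"

definition matchings :: "'u set \<Rightarrow> 'x set \<Rightarrow> ('u \<times> 'x) set set" where
  "matchings U X = {\<sigma>. partial_matching U X \<sigma> \<and> Domain \<sigma> = U \<and> Range \<sigma> = X}"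

text \<open>With \<open>l c\<close> the rightmost vertex of column \<open>c\<close> and \<open>\<rho> x\<close> the column of the vertex \<open>x\<close>,
  this is the graph of the maps \<open>\<psi>\<close>, restricted to the columns \<open>C\<close> whose rightmost vertex is
  critical.  Where it is total on \<open>C\<close>, the forest condition says that it is acyclic.\<close>

definition step :: "'c set \<Rightarrow> ('c \<Rightarrow> 'u) \<Rightarrow> ('x \<Rightarrow> 'c) \<Rightarrow> ('u \<times> 'x) set \<Rightarrow> ('c \<times> 'c) set" where
  "step C l \<rho> h = {(c, \<rho> x) |c x. c \<in> C \<and> (l c, x) \<in> h}"

section \<open>Completions of a partial matching\<close>

lemma partial_matching_subset:
  "partial_matching U X \<sigma> \<Longrightarrow> h \<subseteq> \<sigma> \<Longrightarrow> partial_matching U X h"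
  unfolding partial_matching_def single_valued_def by blast

lemma partial_matching_insert:
  "partial_matching U X h \<Longrightarrow> u \<in> U - Domain h \<Longrightarrow> x \<in> X - Range h \<Longrightarrow>
    partial_matching U X (insert (u, x) h)"
  unfolding partial_matching_def single_valued_def by blast

lemma partial_matching_converse:
  "partial_matching X U (h\<inverse>) \<longleftrightarrow> partial_matching U X h"
  unfolding partial_matching_def by auto

lemma matchings_converse: "\<sigma>\<inverse> \<in> matchings X U \<longleftrightarrow> \<sigma> \<in> matchings U X"
  unfolding matchings_def by (auto simp: partial_matching_converse)

lemma partial_matching_Times: "partial_matching U X h \<Longrightarrow> h \<subseteq> U \<times> X"
  unfolding partial_matching_def by fastforce

lemma finite_matchings:
  assumes "finite U" "finite X"
  shows "finite (matchings U X)"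
proof (rule finite_subset)
  show "matchings U X \<subseteq> Pow (U \<times> X)"
    using partial_matching_Times by (auto simp: matchings_def)
qed (use assms in simp)

lemma partial_matching_finite:
  assumes "partial_matching U X h" "finite U" "finite X"
  shows "finite h"
  using partial_matching_Times[OF assms(1)] assms(2,3) by (meson finite_SigmaI finite_subset)

lemma partial_matching_card:
  assumes "partial_matching U X h"
  shows "card (Domain h) = card h" "card (Range h) = card h"
proof -
  have "inj_on fst h" "inj_on snd h"
    using assms unfolding partial_matching_def single_valued_def inj_on_def by auto
  then show "card (Domain h) = card h" "card (Range h) = card h"
    by (simp_all add: card_image flip: fst_eq_Domain snd_eq_Range)
qed

lemma partial_matching_card_free:
  assumes "partial_matching U X h" "finite X"
  shows "card (X - Range h) = card X - card h"
  using assms partial_matching_card(2)[OF assms(1)] finite_subset[of "Range h" X]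
  by (simp add: card_Diff_subset partial_matching_def)

text \<open>The free vertex \<open>u\<close> has exactly one partner in a perfect matching, and it
  lies outside \<open>Range h\<close>. The predicate \<open>Q\<close> is left open so that counts
  with and without acyclicity share the same split.\<close>

lemma card_matchings_split:
  assumes "finite U" "finite X" "u \<in> U - Domain h"
  shows "card {\<sigma> \<in> matchings U X. h \<subseteq> \<sigma> \<and> Q \<sigma>} =
    (\<Sum>x \<in> X - Range h. card {\<sigma> \<in> matchings U X. insert (u, x) h \<subseteq> \<sigma> \<and> Q \<sigma>})"
proof -
  have "{\<sigma> \<in> matchings U X. h \<subseteq> \<sigma> \<and> Q \<sigma>} =
      (\<Union>x \<in> X - Range h. {\<sigma> \<in> matchings U X. insert (u, x) h \<subseteq> \<sigma> \<and> Q \<sigma>})" (is "?L = ?R")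
  proof
    show "?L \<subseteq> ?R"
    proof
      fix \<sigma> assume \<sigma>: "\<sigma> \<in> ?L"
      then have pm: "partial_matching U X \<sigma>" "Domain \<sigma> = U" "Range \<sigma> = X" "h \<subseteq> \<sigma>" "Q \<sigma>"
        by (auto simp: matchings_def)
      then obtain x where x: "(u, x) \<in> \<sigma>" using assms(3) by blast
      then have "x \<in> X" using pm by blast
      moreover have "x \<notin> Range h"
      proof
        assume "x \<in> Range h"
        then obtain v where "(v, x) \<in> h" by blast
        then have "v = u" using x pm unfolding partial_matching_def single_valued_def by blast
        then show False using \<open>(v, x) \<in> h\<close> assms(3) by blast
      qed
      ultimately show "\<sigma> \<in> ?R" using \<sigma> x by auto
    qed
  qed auto
  also have "card \<dots> =
      (\<Sum>x \<in> X - Range h. card {\<sigma> \<in> matchings U X. insert (u, x) h \<subseteq> \<sigma> \<and> Q \<sigma>})"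
  proof (rule card_UN_disjoint)
    have False if "i \<noteq> j" "\<sigma> \<in> matchings U X" "(u, i) \<in> \<sigma>" "(u, j) \<in> \<sigma>" for i j \<sigma>
      using that unfolding matchings_def partial_matching_def single_valued_def by blast
    then show "\<forall>i\<in>X - Range h. \<forall>j\<in>X - Range h. i \<noteq> j \<longrightarrow>
      {\<sigma> \<in> matchings U X. insert (u, i) h \<subseteq> \<sigma> \<and> Q \<sigma>} \<inter>
      {\<sigma> \<in> matchings U X. insert (u, j) h \<subseteq> \<sigma> \<and> Q \<sigma>} = {}"
      by blast
    show "\<forall>i\<in>X - Range h. finite {\<sigma> \<in> matchings U X. insert (u, i) h \<subseteq> \<sigma> \<and> Q \<sigma>}"
      using finite_matchings[OF assms(1,2)] by simp
  qed (use assms in simp)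
  finally show ?thesis .
qed

lemma card_matchings_extending:
  assumes "finite U" "finite X" "card U = card X" "partial_matching U X h"
  shows "card {\<sigma> \<in> matchings U X. h \<subseteq> \<sigma>} = fact (card U - card h)"
  using assms(4)
proof (induction "card U - card h" arbitrary: h)
  case 0
  note pm = partial_matching_card[OF "0.prems"]
  have sub: "Domain h \<subseteq> U" "Range h \<subseteq> X" using "0.prems" by (auto simp: partial_matching_def)
  have D: "Domain h = U"
    using "0.hyps" pm(1) sub(1) assms(1) card_mono[OF assms(1) sub(1)] by (metis card_subset_eq diff_is_0_eq le_antisym)
  have R: "Range h = X"
    using "0.hyps" pm(2) sub(2) assms(2,3) card_mono[OF assms(2) sub(2)] by (metis card_subset_eq diff_is_0_eq le_antisym)
  have "{\<sigma> \<in> matchings U X. h \<subseteq> \<sigma>} = {h}"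
  proof
    show "{\<sigma> \<in> matchings U X. h \<subseteq> \<sigma>} \<subseteq> {h}"
    proof
      fix \<sigma> assume "\<sigma> \<in> {\<sigma> \<in> matchings U X. h \<subseteq> \<sigma>}"
      then have "single_valued \<sigma>" "Domain \<sigma> = Domain h" "h \<subseteq> \<sigma>"
        using D by (auto simp: matchings_def partial_matching_def)
      then have "\<sigma> = h" by (auto dest: single_valuedD)
      then show "\<sigma> \<in> {h}" by simp
    qed
  qed (use D R "0.prems" in \<open>auto simp: matchings_def\<close>)
  then show ?case using "0.hyps" by simp
next
  case (Suc n)
  note pm = partial_matching_card[OF Suc.prems]
  have sub: "Domain h \<subseteq> U" "Range h \<subseteq> X" using Suc.prems by (auto simp: partial_matching_def)
  have "Domain h \<noteq> U"
  proof
    assume "Domain h = U"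
    then have "card U = card h" using pm(1) by simp
    then show False using Suc.hyps(2) by simp
  qed
  then obtain u where u: "u \<in> U - Domain h" using sub(1) by blast
  have "card {\<sigma> \<in> matchings U X. insert (u, x) h \<subseteq> \<sigma>} = fact n" if x: "x \<in> X - Range h" for x
  proof -
    have "(u, x) \<notin> h" using x by blast
    then have c: "card (insert (u, x) h) = Suc (card h)"
      using partial_matching_finite[OF Suc.prems assms(1,2)] by simp
    have n: "n = card U - card (insert (u, x) h)" using Suc.hyps(2) unfolding c by simp
    show ?thesis
      using Suc.hyps(1)[OF n partial_matching_insert[OF Suc.prems u x]] unfolding n .
  qed
  moreover have "card (X - Range h) = Suc n"
    using Suc.hyps(2) assms(3) partial_matching_card_free[OF Suc.prems assms(2)] by simp
  ultimately show ?case
    using card_matchings_split[OF assms(1,2) u, where Q = "\<lambda>_. True"]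
    unfolding Suc.hyps(2)[symmetric] by simp
qed

section \<open>Step digraphs and acyclic completions\<close>

lemma step_mono: "h \<subseteq> \<sigma> \<Longrightarrow> step C l \<rho> h \<subseteq> step C l \<rho> \<sigma>"
  unfolding step_def by blast

lemma Domain_step: "Domain (step C l \<rho> h) = {c \<in> C. l c \<in> Domain h}"
  unfolding step_def by blast

lemma single_valued_step: "single_valued h \<Longrightarrow> single_valued (step C l \<rho> h)"
  unfolding step_def single_valued_def by blast

lemma finite_step:
  assumes "finite C" "finite h"
  shows "finite (step C l \<rho> h)"
proof (rule finite_subset)
  show "step C l \<rho> h \<subseteq> C \<times> ((\<rho> \<circ> snd) ` h)" unfolding step_def by force
qed (use assms in simp)

lemma step_insert:
  "inj_on l C \<Longrightarrow> c \<in> C \<Longrightarrow> step C l \<rho> (insert (l c, x) h) = insert (c, \<rho> x) (step C l \<rho> h)"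
  unfolding step_def inj_on_def by blast

lemma terminal_exists:
  assumes "finite E" "acyclic E"
  shows "\<exists>k. k \<notin> Domain E \<and> (z, k) \<in> E\<^sup>*"
proof (induction z rule: wf_induct_rule[OF finite_acyclic_wf_converse[OF assms]])
  case (1 z)
  show ?case
  proof (cases "z \<in> Domain E")
    case True
    then obtain y where y: "(z, y) \<in> E" by blast
    with 1[of y] show ?thesis by (meson converse_iff converse_rtrancl_into_rtrancl)
  qed blast
qed

lemma terminal_unique:
  assumes "single_valued E" "(z, k) \<in> E\<^sup>*" "(z, k') \<in> E\<^sup>*" "k \<notin> Domain E" "k' \<notin> Domain E"
  shows "k = k'"
  using single_valued_confluent[OF assms(1-3)] assms(4,5)
  by (metis DomainI converse_rtranclE)

text \<open>In a finite acyclic step digraph a path stops either outside \<open>C\<close>, at a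
  root, or at a column of \<open>C\<close> whose partner is still open. The first alternative is
  singled out here.\<close>

definition rooted :: "'c set \<Rightarrow> ('c \<times> 'c) set \<Rightarrow> 'c \<Rightarrow> bool" where
  "rooted C E z \<longleftrightarrow> (\<exists>k. k \<notin> C \<and> (z, k) \<in> E\<^sup>*)"

text \<open>A path using the new edge splits into a part ending in \<open>c\<close> and a part
  starting in \<open>y\<close>.\<close>

lemma rooted_insert:
  "rooted C (insert (c, y) E) z \<longleftrightarrow> rooted C E z \<or> (z, c) \<in> E\<^sup>* \<and> rooted C E y"
  unfolding rooted_def rtrancl_insert by blast

text \<open>Choosing the partner \<open>x\<close> of a free critical vertex either attaches its whole tree to a root
  (raising the number of rooted targets by the size \<open>k\<close> of the tree, minus the used \<open>x\<close>), or
  leaves that number unchanged, or closes a cycle; so the number \<open>r\<close> of rooted targets among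
  \<open>N\<close> satisfies \<open>r (r + k - 1) + (N - r - k) r = r (N - 1)\<close>.\<close>

lemma card_acyclic_extensions:
  assumes fin: "finite U" "finite X" "finite C" and "card U = card X"
    and l: "inj_on l C" "l ` C \<subseteq> U"
    and "partial_matching U X h" "acyclic (step C l \<rho> h)" "card h < card U"
  shows "card {\<sigma> \<in> matchings U X. h \<subseteq> \<sigma> \<and> acyclic (step C l \<rho> \<sigma>)} =
    card {x \<in> X - Range h. rooted C (step C l \<rho> h) (\<rho> x)} * fact (card U - card h - 1)"
  using assms(7-)
proof (induction "card (C - {c. l c \<in> Domain h})" arbitrary: h)
  case 0
  let ?E = "step C l \<rho> h"
  note pm = \<open>partial_matching U X h\<close>
  have C: "\<forall>c\<in>C. l c \<in> Domain h" using "0.hyps" fin by auto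
  have D: "Domain ?E = C" using C by (auto simp: Domain_step)
  have "finite ?E" using finite_step[OF fin(3) partial_matching_finite[OF pm fin(1,2)]] .
  \<comment> \<open>No critical column is open, so a path can only stop outside \<open>C\<close>:
    every free target is rooted, and acyclicity depends on \<open>h\<close> alone.\<close>
  then have root: "rooted C ?E z" for z
    using terminal_exists "0.prems"(2) D unfolding rooted_def by metis
  have "step C l \<rho> \<sigma> = ?E" if "\<sigma> \<in> matchings U X" "h \<subseteq> \<sigma>" for \<sigma>
  proof -
    have "single_valued \<sigma>" using that by (auto simp: matchings_def partial_matching_def)
    then show ?thesis using C that(2) unfolding step_def single_valued_def by blast
  qed
  then have "{\<sigma> \<in> matchings U X. h \<subseteq> \<sigma> \<and> acyclic (step C l \<rho> \<sigma>)} = {\<sigma> \<in> matchings U X. h \<subseteq> \<sigma>}"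
    using "0.prems"(2) by auto
  moreover have "card (X - Range h) = card U - card h"
    using partial_matching_card_free[OF pm fin(2)] assms(4) by simp
  moreover have "fact (card U - card h) = (card U - card h) * (fact (card U - card h - 1) :: nat)"
    using "0.prems"(3) by (metis fact_reduce of_nat_id zero_less_diff)
  ultimately show ?case
    using card_matchings_extending[OF fin(1,2) assms(4) pm] root by (simp add: set_diff_eq)
next
  case (Suc n)
  let ?E = "step C l \<rho> h"
  let ?Y = "X - Range h"
  define N where "N = card U - card h"
  note pm = \<open>partial_matching U X h\<close>
  have finh: "finite h" using partial_matching_finite[OF pm fin(1,2)] .
  have finE: "finite ?E" using finite_step[OF fin(3) finh] .
  have svE: "single_valued ?E" using pm by (simp add: partial_matching_def single_valued_step)
  have "C - {c. l c \<in> Domain h} \<noteq> {}" using Suc.hyps(2) by (metis card.empty Zero_not_Suc)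
  then obtain c where c: "c \<in> C" "l c \<notin> Domain h" by blast
  have lc: "l c \<in> U - Domain h" using c l by blast
  have cE: "c \<notin> Domain ?E" using c by (simp add: Domain_step)
  have cardY: "card ?Y = N"
    using partial_matching_card_free[OF pm fin(2)] assms(4) by (simp add: N_def)
  have N: "N \<ge> 1" using Suc.prems by (simp add: N_def)
  define S where "S x = {\<sigma> \<in> matchings U X. insert (l c, x) h \<subseteq> \<sigma> \<and> acyclic (step C l \<rho> \<sigma>)}" for x
  \<comment> \<open>\<open>Rt\<close> are the free targets that already lead to a root,
    \<open>Kc\<close> those in the tree hanging at \<open>c\<close>, which would close a cycle if
    chosen for \<open>c\<close>.\<close>
  define Rt where "Rt = {x \<in> ?Y. rooted C ?E (\<rho> x)}"
  define Kc where "Kc = {x \<in> ?Y. (\<rho> x, c) \<in> ?E\<^sup>*}"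
  have finY: "finite ?Y" "finite Rt" "finite Kc" using fin by (auto simp: Rt_def Kc_def)
  have sub: "Rt \<subseteq> ?Y" "Kc \<subseteq> ?Y" by (auto simp: Rt_def Kc_def)
  have disj: "Rt \<inter> Kc = {}"
  proof -
    have False if "k \<notin> C" "(\<rho> x, k) \<in> ?E\<^sup>*" "(\<rho> x, c) \<in> ?E\<^sup>*" for x k
    proof -
      have "k \<notin> Domain ?E" using that by (simp add: Domain_step)
      then have "k = c" using terminal_unique[OF svE that(2,3)] cE by blast
      then show False using that c by blast
    qed
    then show ?thesis by (auto simp: Rt_def Kc_def rooted_def)
  qed
  have split: "card {\<sigma> \<in> matchings U X. h \<subseteq> \<sigma> \<and> acyclic (step C l \<rho> \<sigma>)} = (\<Sum>x\<in>?Y. card (S x))"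
    unfolding S_def using card_matchings_split[OF fin(1,2) lc] .
  have st: "step C l \<rho> (insert (l c, x) h) = insert (c, \<rho> x) ?E" for x
    using step_insert[OF l(1) c(1)] .
  have cyc: "card (S x) = 0" if "x \<in> Kc" for x
  proof -
    have "\<not> acyclic (step C l \<rho> (insert (l c, x) h))"
      using that by (simp add: st acyclic_insert Kc_def)
    then have "\<not> acyclic (step C l \<rho> \<sigma>)" if "insert (l c, x) h \<subseteq> \<sigma>" for \<sigma>
      using acyclic_subset step_mono[OF that] by metis
    then have "S x = {}" unfolding S_def by blast
    then show ?thesis by simp
  qed
  have acyc: "acyclic (step C l \<rho> (insert (l c, x) h))" if "x \<in> ?Y - Kc" for x
  proof -
    have "(\<rho> x, c) \<notin> ?E\<^sup>*" using that unfolding Kc_def by blast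
    then show ?thesis using Suc.prems(2) by (simp add: st acyclic_insert)
  qed
  have pm': "partial_matching U X (insert (l c, x) h)" if "x \<in> ?Y" for x
    using partial_matching_insert[OF pm lc that] .
  have card': "card (insert (l c, x) h) = Suc (card h)" for x
  proof -
    have "(l c, x) \<notin> h" using c(2) by blast
    then show ?thesis using finh by simp
  qed
  show ?case
  \<comment> \<open>The induction hypothesis needs a free vertex after \<open>l c\<close> has been
    paired, so the last pair is treated directly.\<close>
  proof (cases "N = 1")
    case True
    then obtain x where Y: "?Y = {x}" using cardY by (metis card_1_singletonE)
    show ?thesis
    proof (cases "x \<in> Kc")
      case True
      have "Rt \<subseteq> {x}" using sub(1) Y by simp
      then have "Rt = {}" using disj True by blast
      then show ?thesis using split Y cyc[OF True] unfolding Rt_def by simp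
    next
      case False
      have full: "card (insert (l c, x) h) = card U" using card' \<open>N = 1\<close> N_def Suc.prems by simp
      have pmx: "partial_matching U X (insert (l c, x) h)" using pm'[of x] Y by simp
      have one: "card {\<sigma> \<in> matchings U X. insert (l c, x) h \<subseteq> \<sigma>} = 1"
        using card_matchings_extending[OF fin(1,2) assms(4) pmx] full by simp
      have "\<sigma> = insert (l c, x) h" if "\<sigma> \<in> matchings U X" "insert (l c, x) h \<subseteq> \<sigma>" for \<sigma>
      proof -
        have "partial_matching U X \<sigma>" "Domain \<sigma> = U" using that by (auto simp: matchings_def)
        then have "finite \<sigma>" "card \<sigma> = card U"
          using partial_matching_finite[OF _ fin(1,2)] partial_matching_card(1)[of U X \<sigma>] by simp_all
        then show ?thesis using card_subset_eq[OF _ that(2)] full by metis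
      qed
      then have "S x = {\<sigma> \<in> matchings U X. insert (l c, x) h \<subseteq> \<sigma>}"
        using acyc[of x] Y False unfolding S_def by fastforce
      then have Sx: "card (S x) = 1" using one by simp
      have Dom: "Domain (insert (l c, x) h) = U"
        using pmx full partial_matching_card(1)[OF pmx] fin(1)
        by (intro card_subset_eq) (simp_all add: partial_matching_def)
      \<comment> \<open>All columns of \<open>C\<close> except \<open>c\<close> already have an
        edge, and the path from \<open>\<rho> x\<close> avoids \<open>c\<close>; hence it ends
        outside \<open>C\<close>.\<close>
      obtain k where k: "k \<notin> Domain ?E" "(\<rho> x, k) \<in> ?E\<^sup>*"
        using terminal_exists[OF finE Suc.prems(2)] by blast
      have "k \<notin> C"
      proof
        assume "k \<in> C"
        then have "l k \<notin> Domain h" "l k \<in> U" using k l by (auto simp: Domain_step)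
        then have "l k = l c" using Dom by auto
        then have "k = c" using inj_onD[OF l(1)] c \<open>k \<in> C\<close> by metis
        then show False using k False Y by (auto simp: Kc_def)
      qed
      then have "Rt = {x}" using Y k by (auto simp: Rt_def rooted_def)
      then show ?thesis using split Y Sx \<open>N = 1\<close> unfolding Rt_def N_def by simp
    qed
  next
    case False
    then have N2: "N \<ge> 2" using N by simp
    have IH: "card (S x) =
        card {x' \<in> ?Y - {x}. rooted C ?E (\<rho> x') \<or> (\<rho> x', c) \<in> ?E\<^sup>* \<and> rooted C ?E (\<rho> x)} * fact (N - 2)"
      if x: "x \<in> ?Y - Kc" for x
    proof -
      have "C - {c'. l c' \<in> Domain (insert (l c, x) h)} = C - {c'. l c' \<in> Domain h} - {c}"
        using inj_onD[OF l(1)] c(1) by blast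
      then have n: "n = card (C - {c'. l c' \<in> Domain (insert (l c, x) h)})"
        using Suc.hyps(2) c by simp
      have less: "card (insert (l c, x) h) < card U" using N2 card' by (simp add: N_def)
      have "card (S x) = card {x' \<in> X - Range (insert (l c, x) h).
          rooted C (insert (c, \<rho> x) ?E) (\<rho> x')} * fact (card U - Suc (card h) - 1)"
        using Suc.hyps(1)[OF n pm'[of x] acyc[OF x] less] x unfolding S_def st card' by simp
      moreover have "X - Range (insert (l c, x) h) = ?Y - {x}" by auto
      moreover have "card U - Suc (card h) - 1 = N - 2" by (simp add: N_def)
      ultimately show ?thesis by (simp only: rooted_insert)
    qed
    have S_Rt: "card (S x) = (card Rt + card Kc - 1) * fact (N - 2)" if x: "x \<in> Rt" for x
    proof -
      have "{x' \<in> ?Y - {x}. rooted C ?E (\<rho> x') \<or> (\<rho> x', c) \<in> ?E\<^sup>* \<and> rooted C ?E (\<rho> x)} =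
          Rt \<union> Kc - {x}" using x unfolding Rt_def Kc_def by blast
      moreover have "card (Rt \<union> Kc - {x}) = card Rt + card Kc - 1"
        using x finY disj by (simp add: card_Un_disjoint)
      moreover have "x \<in> ?Y - Kc" using x disj sub by blast
      ultimately show ?thesis using IH by presburger
    qed
    have S_other: "card (S x) = card Rt * fact (N - 2)" if x: "x \<in> ?Y - (Rt \<union> Kc)" for x
    proof -
      have "{x' \<in> ?Y - {x}. rooted C ?E (\<rho> x') \<or> (\<rho> x', c) \<in> ?E\<^sup>* \<and> rooted C ?E (\<rho> x)} = Rt"
        using x unfolding Rt_def by blast
      moreover have "x \<in> ?Y - Kc" using x by blast
      ultimately show ?thesis using IH by presburger
    qed
    let ?r = "card Rt" and ?k = "card Kc"
    have rkN: "?r + ?k \<le> N"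
      using card_mono[OF finY(1), of "Rt \<union> Kc"] sub disj finY cardY by (simp add: card_Un_disjoint)
    have "(\<Sum>x\<in>?Y. card (S x)) = (\<Sum>x\<in>Rt. card (S x)) + (\<Sum>x\<in>Kc. card (S x))
        + (\<Sum>x\<in>?Y - (Rt \<union> Kc). card (S x))"
      using sum.subset_diff[of "Rt \<union> Kc" ?Y "\<lambda>x. card (S x)"] sub finY disj
      by (simp add: sum.union_disjoint)
    also have "\<dots> = ?r * ((?r + ?k - 1) * fact (N - 2)) + (N - (?r + ?k)) * (?r * fact (N - 2))"
      using S_Rt S_other cyc cardY sub finY disj
      by (simp add: card_Diff_subset card_Un_disjoint)
    also have "\<dots> = ?r * ((?r + ?k - 1 + (N - (?r + ?k))) * fact (N - 2))"
      by (simp add: algebra_simps)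
    \<comment> \<open>The difference \<open>?r + ?k - 1\<close> could be truncated only if
      \<open>?r = 0\<close>, and then both sides vanish.\<close>
    also have "\<dots> = ?r * ((N - 1) * fact (N - 2))"
      using rkN by (cases "?r = 0") auto
    also have "(N - 1) * fact (N - 2) = (fact (N - 1) :: nat)"
      using N2 fact_reduce[of "N - 1", where ?'a = nat] by (simp add: numeral_2_eq_2)
    finally show ?thesis using split by (simp add: Rt_def N_def)
  qed
qed

section \<open>Paths, orbits and binomial sums\<close>

text \<open>Each column has at most one successor, so a path from \<open>j\<close> is determined by
  its length; acyclicity makes its columns distinct, so it exists exactly while \<open>m\<close>
  edges fit into the orbit of \<open>j\<close>.\<close>

lemma card_paths_from:
  assumes fin: "finite E" and "single_valued E" and ac: "acyclic E"
  shows "card {J. length J = m \<and> successively (\<lambda>x y. (x, y) \<in> E) (j # J)} =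
    (if m < card (E\<^sup>* `` {j}) then 1 else 0)"
proof (induction j arbitrary: m rule: wf_induct_rule[OF finite_acyclic_wf_converse[OF fin ac]])
  case (1 j)
  show ?case
  proof (cases "j \<in> Domain E")
    case False
    have "E\<^sup>* `` {j} = {j}" using False by (auto elim: converse_rtranclE)
    moreover have "{J. length J = m \<and> successively (\<lambda>x y. (x, y) \<in> E) (j # J)} =
        (if m = 0 then {[]} else {})"
      using False by (auto simp: successively_Cons)
    ultimately show ?thesis by simp
  next
    case True
    then obtain k where k: "(j, k) \<in> E" by blast
    have k_unique: "k' = k" if "(j, k') \<in> E" for k'
      using single_valuedD[OF assms(2) that k] .
    have reach: "E\<^sup>* `` {j} = insert j (E\<^sup>* `` {k})"
    proof
      show "E\<^sup>* `` {j} \<subseteq> insert j (E\<^sup>* `` {k})"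
      proof
        fix x assume "x \<in> E\<^sup>* `` {j}"
        then have "(j, x) \<in> E\<^sup>*" by simp
        then show "x \<in> insert j (E\<^sup>* `` {k})"
          by (cases rule: converse_rtranclE) (use k_unique in auto)
      qed
      show "insert j (E\<^sup>* `` {k}) \<subseteq> E\<^sup>* `` {j}"
        using converse_rtrancl_into_rtrancl[OF k] by blast
    qed
    have notin: "j \<notin> E\<^sup>* `` {k}"
    proof
      assume "j \<in> E\<^sup>* `` {k}"
      then have "(j, j) \<in> E\<^sup>+" using rtrancl_into_trancl2[OF k] by simp
      then show False using ac by (simp add: acyclic_def)
    qed
    have "E\<^sup>* `` {k} \<subseteq> insert k (Range E)" by (auto elim: rtranclE)
    then have "finite (E\<^sup>* `` {k})" by (rule finite_subset) (use fin in \<open>simp add: finite_Range\<close>)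
    then have c: "card (E\<^sup>* `` {j}) = Suc (card (E\<^sup>* `` {k}))" using reach notin by simp
    show ?thesis
    proof (cases m)
      case 0
      then have "{J. length J = m \<and> successively (\<lambda>x y. (x, y) \<in> E) (j # J)} = {[]}" by auto
      then show ?thesis using 0 c by simp
    next
      case (Suc n)
      have "{J. length J = m \<and> successively (\<lambda>x y. (x, y) \<in> E) (j # J)} =
          (#) k ` {J. length J = n \<and> successively (\<lambda>x y. (x, y) \<in> E) (k # J)}"
      proof
        show "{J. length J = m \<and> successively (\<lambda>x y. (x, y) \<in> E) (j # J)} \<subseteq>
          (#) k ` {J. length J = n \<and> successively (\<lambda>x y. (x, y) \<in> E) (k # J)}"
        proof
          fix J assume "J \<in> {J. length J = m \<and> successively (\<lambda>x y. (x, y) \<in> E) (j # J)}"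
          then have J: "length J = Suc n" "successively (\<lambda>x y. (x, y) \<in> E) (j # J)"
            using Suc by auto
          then obtain a J' where "J = a # J'" by (cases J) auto
          then show "J \<in> (#) k ` {J. length J = n \<and> successively (\<lambda>x y. (x, y) \<in> E) (k # J)}"
            using J k_unique[of a] by simp
        qed
      qed (use k Suc in auto)
      then have "card {J. length J = m \<and> successively (\<lambda>x y. (x, y) \<in> E) (j # J)} =
          card {J. length J = n \<and> successively (\<lambda>x y. (x, y) \<in> E) (k # J)}"
        by (simp add: card_image)
      then show ?thesis using 1[of k n] k c Suc by simp
    qed
  qed
qed

lemma successively_trancl:
  assumes "successively (\<lambda>x y. (x, y) \<in> E) (j # J)" "y \<in> set J"
  shows "(j, y) \<in> E\<^sup>+"
  using assms
proof (induction J arbitrary: j)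
  case (Cons a J)
  then show ?case by (auto intro: trancl_into_trancl2)
qed simp

lemma successively_acyclic_distinct:
  assumes "acyclic E" "successively (\<lambda>x y. (x, y) \<in> E) (j # J)"
  shows "distinct (j # J)"
  using assms(2)
proof (induction J arbitrary: j)
  case (Cons a J)
  have "j \<notin> set (a # J)" using successively_trancl[OF Cons.prems] assms(1) by (auto simp: acyclic_def)
  moreover have "distinct (a # J)" using Cons.IH[of a] Cons.prems by simp
  ultimately show ?case by simp
qed simp

text \<open>With \<open>B\<close> put in order, summand \<open>m\<close> counts the sets whose first
  member from \<open>B\<close> has \<open>m\<close> predecessors there. In the proof the sum arises
  by peeling off one element at a time with Pascal's rule.\<close>

lemma card_subsets_meeting:
  assumes "finite A" "B \<subseteq> A" "R \<ge> 1"
  shows "card {P. P \<subseteq> A \<and> card P = R \<and> P \<inter> B \<noteq> {}} =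
    (\<Sum>m<card B. (card A - m - 1) choose (R - 1))"
proof -
  have split: "card A choose R = ((card A - b) choose R) + (\<Sum>m<b. (card A - m - 1) choose (R - 1))"
    if "b \<le> card A" for b
    using that
  proof (induction b)
    case (Suc b)
    then have "card A - b = Suc (card A - b - 1)" by simp
    then have "(card A - b) choose R = ((card A - b - 1) choose (R - 1)) + ((card A - b - 1) choose R)"
      using assms(3) by (metis Suc_diff_1 binomial_Suc_Suc less_eq_Suc_le One_nat_def)
    then show ?case using Suc by simp
  qed simp
  let ?S = "{P. P \<subseteq> A \<and> card P = R}" and ?T = "{P. P \<subseteq> A - B \<and> card P = R}"
  have "{P. P \<subseteq> A \<and> card P = R \<and> P \<inter> B \<noteq> {}} = ?S - ?T" by blast
  moreover have "?T \<subseteq> ?S" by blast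
  moreover have "finite ?T" using assms(1) by simp
  ultimately have "card {P. P \<subseteq> A \<and> card P = R \<and> P \<inter> B \<noteq> {}} = card ?S - card ?T"
    by (simp add: card_Diff_subset)
  also have "card ?S = card A choose R" using n_subsets[OF assms(1)] .
  also have "card ?T = (card A - card B) choose R"
    using n_subsets[of "A - B" R] assms by (simp add: card_Diff_subset finite_subset)
  finally show ?thesis using split[of "card B"] card_mono[OF assms(1,2)] by simp
qed

text \<open>Vandermonde's identity indexed by \<open>A\<close>, where \<open>M - A\<close> elements
  are taken from the first \<open>M - m\<close>. The conditional supplies the value 0 where
  \<open>q - (M - A)\<close> would be truncated.\<close>

lemma vandermonde_shifted:
  assumes "m \<le> M"
  shows "(M - m + n) choose q =
    (\<Sum>A=m..M. ((M - m) choose (A - m)) * (if M - A \<le> q then n choose (q - (M - A)) else 0))"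
proof -
  let ?f = "\<lambda>i. ((M - m) choose i) * (if i \<le> q then n choose (q - i) else 0)"
  have "(M - m + n) choose q = (\<Sum>i\<le>q. ((M - m) choose i) * (n choose (q - i)))"
    using vandermonde[of "M - m" n q] by simp
  also have "\<dots> = (\<Sum>i\<le>q. ?f i)" by simp
  \<comment> \<open>The two ranges are compared inside a common larger one: summands beyond
    \<open>q\<close> vanish by the conditional, those beyond \<open>M - m\<close> by the first
    binomial.\<close>
  also have "\<dots> = (\<Sum>i\<le>q + (M - m). ?f i)" by (rule sum.mono_neutral_left) auto
  also have "\<dots> = (\<Sum>i\<le>M - m. ?f i)" by (rule sum.mono_neutral_right) auto
  also have "\<dots> = (\<Sum>A=m..M. ((M - m) choose (M - A)) * (if M - A \<le> q then n choose (q - (M - A)) else 0))"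
    by (rule sum.reindex_bij_witness[where i = "\<lambda>A. M - A" and j = "\<lambda>i. M - i"]) (use assms in auto)
  also have "\<dots> = (\<Sum>A=m..M. ((M - m) choose (A - m)) * (if M - A \<le> q then n choose (q - (M - A)) else 0))"
  proof (rule sum.cong[OF refl])
    fix A assume "A \<in> {m..M}"
    then have "M - A \<le> M - m" "M - m - (M - A) = A - m" using assms by auto
    then have "(M - m) choose (M - A) = (M - m) choose (A - m)"
      using binomial_symmetric[of "M - A" "M - m"] by simp
    then show "((M - m) choose (M - A)) * (if M - A \<le> q then n choose (q - (M - A)) else 0) =
      ((M - m) choose (A - m)) * (if M - A \<le> q then n choose (q - (M - A)) else 0)" by simp
  qed
  finally show ?thesis .
qed

text \<open>Each summand is \<open>fact A * fact (s - A - 1)\<close> times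
  \<open>(s - 1 - m) choose (A - m)\<close>; the hockey-stick identity sums these binomials to
  \<open>s choose A\<close>.\<close>

lemma sum_falling_fact:
  assumes "A < s"
  shows "(\<Sum>m\<le>A. fact A / fact (A - m) * fact (s - m - 1)) = (fact s / (real s - real A) :: real)"
proof -
  have "fact A / fact (A - m) * fact (s - m - 1) =
      (fact A * fact (s - A - 1) * real ((s - 1 - m) choose (A - m)) :: real)" if "m \<le> A" for m
  proof -
    have "s - 1 - m - (A - m) = s - A - 1" using that assms by simp
    then show ?thesis using that assms by (simp add: binomial_fact field_simps)
  qed
  then have "(\<Sum>m\<le>A. fact A / fact (A - m) * fact (s - m - 1)) =
      (fact A * fact (s - A - 1) * real (\<Sum>m\<le>A. (s - 1 - m) choose (A - m)) :: real)"
    by (simp add: sum_distrib_left)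
  also have "(\<Sum>m\<le>A. (s - 1 - m) choose (A - m)) = s choose A"
    using sum_choose_diagonal[of A "s - 1"] assms by simp
  also have "fact A * fact (s - A - 1) * real (s choose A) = fact s / (real s - real A)"
  proof -
    have "fact (s - A) = (real s - real A) * fact (s - A - 1)"
      using assms fact_reduce[of "s - A", where ?'a = real] by (simp add: of_nat_diff)
    then have "fact A * fact (s - A - 1) * real (s choose A) * (real s - real A) = fact s"
      using assms by (simp add: binomial_fact)
    then show ?thesis using assms by (simp add: eq_divide_eq)
  qed
  finally show ?thesis .
qed

text \<open>Vandermonde's identity introduces \<open>A\<close>, and
  \<open>((M - m) choose (A - m)) * M! / (M - m)!\<close> equals
  \<open>(M choose A) * A! / (A - m)!\<close>. After exchanging the sums,
  \<open>sum_falling_fact\<close> evaluates the inner sum over \<open>m\<close>.\<close>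

lemma sum_falling_binomial:
  fixes M n q s :: nat
  assumes "M < s"
  shows "(\<Sum>m\<le>M. real ((M - m + n) choose q) * (fact M / fact (M - m)) * fact (s - m - 1)) =
    fact s * (\<Sum>A\<le>M. 1 / (real s - real A) * real (M choose A) *
      real (if M - A \<le> q then n choose (q - (M - A)) else 0))"
proof -
  define c where "c A = real (if M - A \<le> q then n choose (q - (M - A)) else 0)" for A
  have "(\<Sum>m\<le>M. real ((M - m + n) choose q) * (fact M / fact (M - m)) * fact (s - m - 1)) =
      (\<Sum>m\<le>M. \<Sum>A=m..M. real ((M - m) choose (A - m)) * c A * (fact M / fact (M - m)) * fact (s - m - 1))"
    by (intro sum.cong refl)
      (simp only: atMost_iff vandermonde_shifted c_def of_nat_sum of_nat_mult sum_distrib_right)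
  also have "\<dots> = (\<Sum>m\<le>M. \<Sum>A=m..M. real (M choose A) * c A * (fact A / fact (A - m) * fact (s - m - 1)))"
  proof (intro sum.cong refl)
    fix m A assume "m \<in> {..M}" "A \<in> {m..M}"
    then have "m \<le> A" "A \<le> M" "M - m - (A - m) = M - A" by auto
    then show "real ((M - m) choose (A - m)) * c A * (fact M / fact (M - m)) * fact (s - m - 1) =
        real (M choose A) * c A * (fact A / fact (A - m) * fact (s - m - 1))"
      by (simp add: binomial_fact mult_ac)
  qed
  also have "\<dots> = (\<Sum>A\<le>M. \<Sum>m\<le>A. real (M choose A) * c A * (fact A / fact (A - m) * fact (s - m - 1)))"
  proof -
    let ?g = "\<lambda>m A. real (M choose A) * c A * (fact A / fact (A - m) * fact (s - m - 1))"
    have "(\<Sum>m\<le>M. \<Sum>A=m..M. ?g m A) = (\<Sum>m\<le>M. \<Sum>A | A \<in> {..M} \<and> m \<le> A. ?g m A)"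
      by (intro sum.cong refl) auto
    also have "\<dots> = (\<Sum>A\<le>M. \<Sum>m | m \<in> {..M} \<and> m \<le> A. ?g m A)"
      by (rule sum.swap_restrict) auto
    also have "\<dots> = (\<Sum>A\<le>M. \<Sum>m\<le>A. ?g m A)"
      by (intro sum.cong refl) auto
    finally show ?thesis .
  qed
  also have "\<dots> = (\<Sum>A\<le>M. real (M choose A) * c A * (fact s / (real s - real A)))"
    using assms by (intro sum.cong refl) (simp only: sum_distrib_left[symmetric] sum_falling_fact
      atMost_iff le_less_trans)
  finally show ?thesis by (simp add: c_def sum_distrib_left mult_ac)
qed

section \<open>Two forests on one matching\<close>

text \<open>Here \<open>C\<close> are the critical columns of row 1, \<open>F\<close> the nonempty columns, \<open>last\<close> is the rightmost
  vertex of a column, and \<open>g\<close> replaces a column with an arrow-tail by the column of its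
  arrow-head.  Both rows have the same vertex set \<open>V\<close>, as their cell sizes agree.\<close>

locale two_rows =
  fixes V :: "'v set" and F C :: "'c set"
    and last :: "'c \<Rightarrow> 'v" and col :: "'v \<Rightarrow> 'c" and g :: "'c \<Rightarrow> 'c"
  assumes finV: "finite V" and finF: "finite F" and CF: "C \<subseteq> F"
    and lastV: "last ` F \<subseteq> V" and col_last: "j \<in> F \<Longrightarrow> col (last j) = j"
    and colF: "col ` V \<subseteq> F" and g_C: "c \<in> C \<Longrightarrow> g c = c"
    and few: "card C < card V"
begin

abbreviation E1 :: "('v \<times> 'v) set \<Rightarrow> ('c \<times> 'c) set" where
  "E1 \<sigma> \<equiv> step C last (\<lambda>v. g (col v)) \<sigma>"

text \<open>Row 2 reads the matching backwards and has no arrows; its digraph stops at the marked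
  columns \<open>P\<close>.\<close>

abbreviation E2 :: "'c set \<Rightarrow> ('v \<times> 'v) set \<Rightarrow> ('c \<times> 'c) set" where
  "E2 P \<sigma> \<equiv> step (F - P) last col (\<sigma>\<inverse>)"

text \<open>The targets that are rooted before any pair is fixed; for an array these are the
  \<open>r\<close> vertices in the marked columns of row 1.\<close>

definition roots :: nat where
  "roots = card {v \<in> V. g (col v) \<notin> C}"

lemma finC: "finite C"
  using CF finF by (rule finite_subset)

lemma inj_last: "inj_on last F"
  using col_last by (rule inj_on_inverseI)

lemma inj_last_C: "inj_on last C"
  using inj_last CF by (rule inj_on_subset)

lemma last_CV: "last ` C \<subseteq> V"
  using CF lastV by blast

text \<open>The pairs that make \<open>j, J ! 0, J ! 1, \<dots>\<close> a path of the second row; in the first row they form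
  the reversed path.\<close>

fun chain :: "'c \<Rightarrow> 'c list \<Rightarrow> ('v \<times> 'v) set" where
  "chain j [] = {}"
| "chain j (a # J) = insert (last a, last j) (chain a J)"

section \<open>Chains in the first row\<close>

lemma Domain_chain: "Domain (chain j J) = last ` set J"
  by (induction j J rule: chain.induct) auto

lemma Range_chain: "Range (chain j J) \<subseteq> last ` insert j (set J)"
  by (induction j J rule: chain.induct) auto

lemma partial_matching_chain:
  assumes "distinct (j # J)" "set (j # J) \<subseteq> F"
  shows "partial_matching V V (chain j J)"
  using assms
proof (induction j J rule: chain.induct)
  case (1 j)
  then show ?case by (simp add: partial_matching_def)
next
  case (2 j a J)
  have "last a \<notin> last ` set J" "last j \<notin> last ` insert a (set J)"
    using 2 inj_onD[OF inj_last] by (auto; blast)+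
  then have "last a \<in> V - Domain (chain a J)" "last j \<in> V - Range (chain a J)"
    using 2 lastV Range_chain[of a J] by (auto simp: Domain_chain)
  then show ?case using 2 partial_matching_insert by simp
qed

lemma card_chain:
  assumes "distinct J" "set J \<subseteq> F"
  shows "card (chain j J) = length J"
  using assms
proof (induction j J rule: chain.induct)
  case (2 j a J)
  have "last a \<notin> last ` set J" using 2 inj_onD[OF inj_last] by auto
  then have "(last a, last j) \<notin> chain a J" using Domain_chain by blast
  moreover have "finite (chain j J)" for j J by (induction j J rule: chain.induct) auto
  ultimately show ?case using 2 by simp
qed simp

lemma step_chain:
  assumes "a \<in> C" "j \<in> F"
  shows "E1 (chain j (a # J)) = insert (a, g j) (E1 (chain a J))"
  using step_insert[OF inj_last_C assms(1), of "\<lambda>v. g (col v)" "last j" "chain a J"]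
    col_last[OF assms(2)] by simp

text \<open>In row 1 the pairs are traversed from the end of \<open>J\<close> to its head and on to
  \<open>g j\<close>; on \<open>J\<close> itself \<open>g\<close> is the identity because
  \<open>set J\<close> lies in \<open>C\<close>.\<close>

lemma chain_reaches:
  assumes "z \<in> set J" "set J \<subseteq> C" "j \<in> F"
  shows "(z, g j) \<in> (E1 (chain j J))\<^sup>+"
  using assms
proof (induction j J rule: chain.induct)
  case (2 j a J)
  have a: "a \<in> C" "a \<in> F" using 2 CF by auto
  note st = step_chain[OF a(1) 2(4), of J]
  show ?case
  proof (cases "z = a")
    case True
    then show ?thesis unfolding st by blast
  next
    case False
    then have "(z, g a) \<in> (E1 (chain a J))\<^sup>+" using 2 a by auto
    then have "(z, a) \<in> (insert (a, g j) (E1 (chain a J)))\<^sup>+"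
      using g_C[OF a(1)] trancl_mono[OF _ subset_insertI] by metis
    then show ?thesis unfolding st by (rule trancl_into_trancl) simp
  qed
qed simp

lemma Domain_step_chain:
  "set J \<subseteq> C \<Longrightarrow> Domain (E1 (chain j J)) = set J"
  using inj_onD[OF inj_last_C] by (auto simp: Domain_step Domain_chain)

lemma acyclic_chain:
  assumes "distinct J" "set J \<subseteq> C" "j \<in> F" "g j \<notin> set J"
  shows "acyclic (E1 (chain j J))"
  using assms
proof (induction j J rule: chain.induct)
  case (1 j)
  then show ?case by (simp add: step_def acyclic_def)
next
  case (2 j a J)
  have a: "a \<in> C" "a \<in> F" using 2 CF by auto
  have "acyclic (E1 (chain a J))" using 2 a g_C by simp
  moreover have "g j \<notin> Domain (E1 (chain a J))" "g j \<noteq> a"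
    using 2 Domain_step_chain[of J a] by auto
  then have "(g j, a) \<notin> (E1 (chain a J))\<^sup>*" by (meson DomainI converse_rtranclE)
  ultimately show ?case unfolding step_chain[OF a(1) 2(4)] by (simp add: acyclic_insert)
qed

text \<open>All edges lead along \<open>J\<close> towards \<open>g j\<close>, so either all of
  \<open>J\<close> is rooted or none of it; the other columns of \<open>C\<close> have no outgoing
  edge.\<close>

lemma rooted_chain:
  assumes "set J \<subseteq> C" "j \<in> F"
  shows "rooted C (E1 (chain j J)) z \<longleftrightarrow> z \<notin> C \<or> z \<in> set J \<and> g j \<notin> C"
  using assms
proof (induction j J arbitrary: z rule: chain.induct)
  case (1 j)
  then show ?case by (simp add: step_def rooted_def)
next
  case (2 j a J)
  have a: "a \<in> C" "a \<in> F" using 2 CF by auto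
  have IH: "rooted C (E1 (chain a J)) z \<longleftrightarrow> z \<notin> C" for z using 2 a g_C by simp
  have "(z, a) \<in> (E1 (chain a J))\<^sup>* \<longleftrightarrow> z \<in> set (a # J)"
  proof
    assume "(z, a) \<in> (E1 (chain a J))\<^sup>*"
    then have "z = a \<or> z \<in> Domain (E1 (chain a J))" by (meson DomainI converse_rtranclE)
    then show "z \<in> set (a # J)" using Domain_step_chain[of J a] 2 by auto
  next
    assume "z \<in> set (a # J)"
    then show "(z, a) \<in> (E1 (chain a J))\<^sup>*"
      using chain_reaches[of z J a] 2 a g_C by (auto dest: trancl_into_rtrancl)
  qed
  then show ?case unfolding step_chain[OF a(1) 2(3)] rooted_insert IH by auto
qed

text \<open>By \<open>card_acyclic_extensions\<close> it remains to count free rooted targets. If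
  \<open>g j\<close> lies on \<open>J\<close>, the chain contains a cycle. If \<open>g j\<close> is
  another column of \<open>C\<close>, no column of \<open>J\<close> is rooted and the chain uses no
  rooted target. If \<open>g j\<close> is outside \<open>C\<close>, all of \<open>J\<close> is
  rooted, and so are the \<open>length J\<close> targets used by the chain.\<close>

lemma card_extending_chain:
  assumes J: "distinct J" "set J \<subseteq> C" and j: "j \<in> F"
  shows "card {\<sigma> \<in> matchings V V. chain j J \<subseteq> \<sigma> \<and> acyclic (E1 \<sigma>)} =
    (if g j \<in> set J then 0
     else if g j \<in> C then roots * fact (card V - length J - 1)
     else (roots + card {v \<in> V. g (col v) \<in> set J} - length J) * fact (card V - length J - 1))"
proof (cases "g j \<in> set J")
  case True
  have "\<not> acyclic (E1 \<sigma>)" if "chain j J \<subseteq> \<sigma>" for \<sigma>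
  proof -
    have "(g j, g j) \<in> (E1 (chain j J))\<^sup>+" using chain_reaches[OF True J(2) j] .
    then have "(g j, g j) \<in> (E1 \<sigma>)\<^sup>+" using trancl_mono step_mono[OF that] by metis
    then show ?thesis unfolding acyclic_def by blast
  qed
  then have "{\<sigma> \<in> matchings V V. chain j J \<subseteq> \<sigma> \<and> acyclic (E1 \<sigma>)} = {}" by blast
  then show ?thesis using True by (simp only: card.empty if_True)
next
  case False
  have "j \<notin> set J" using False J(2) g_C by auto
  then have d: "distinct (j # J)" "set (j # J) \<subseteq> F" using J j CF by auto
  have pm: "partial_matching V V (chain j J)" using partial_matching_chain[OF d] .
  have cc: "card (chain j J) = length J" using card_chain d by simp
  have "length J \<le> card C" using J finC by (metis card_mono distinct_card)
  then have less: "card (chain j J) < card V" using few cc by simp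
  let ?r = "{v \<in> V. g (col v) \<notin> C}" and ?k = "{v \<in> V. g (col v) \<in> set J}"
  have main: "card {\<sigma> \<in> matchings V V. chain j J \<subseteq> \<sigma> \<and> acyclic (E1 \<sigma>)} =
      card {v \<in> V - Range (chain j J). g (col v) \<notin> C \<or> g (col v) \<in> set J \<and> g j \<notin> C}
        * fact (card V - length J - 1)"
    using card_acyclic_extensions[OF finV finV finC refl inj_last_C last_CV pm
        acyclic_chain[OF J j False] less]
    unfolding cc rooted_chain[OF J(2) j] .
  have ran: "v = last j \<or> v \<in> last ` set J" if "v \<in> Range (chain j J)" for v
    using that Range_chain[of j J] by blast
  have gran: "v \<in> V" "g (col v) = g j \<or> g (col v) \<in> set J" if "v \<in> Range (chain j J)" for v
  proof -
    show "v \<in> V" using ran[OF that] d(2) lastV by auto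
    show "g (col v) = g j \<or> g (col v) \<in> set J"
      using ran[OF that]
    proof
      assume "v \<in> last ` set J"
      then obtain c where "c \<in> set J" "v = last c" by blast
      moreover from this have "col (last c) = c" "g c = c"
        using J(2) CF col_last[of c] g_C[of c] by auto
      ultimately show ?thesis by simp
    qed (simp add: col_last[OF j])
  qed
  have fin: "finite ?r" "finite ?k" using finV by auto
  have disj: "?r \<inter> ?k = {}" using J(2) by auto
  show ?thesis
  proof (cases "g j \<in> C")
    case True
    have "g (col v) \<in> C" if "v \<in> Range (chain j J)" for v using gran(2)[OF that] True J(2) by auto
    then have "{v \<in> V - Range (chain j J). g (col v) \<notin> C \<or> g (col v) \<in> set J \<and> g j \<notin> C} = ?r"
      using True by blast
    then show ?thesis using main True False by (simp add: roots_def)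
  next
    case g: False
    have sub: "Range (chain j J) \<subseteq> ?r \<union> ?k"
    proof
      fix v assume "v \<in> Range (chain j J)"
      from gran[OF this] g show "v \<in> ?r \<union> ?k" by auto
    qed
    have "{v \<in> V - Range (chain j J). g (col v) \<notin> C \<or> g (col v) \<in> set J \<and> g j \<notin> C} =
        ?r \<union> ?k - Range (chain j J)" using g by blast
    moreover have "card (?r \<union> ?k - Range (chain j J)) = card (?r \<union> ?k) - card (Range (chain j J))"
      using sub fin by (intro card_Diff_subset) (auto intro: finite_subset)
    moreover have "card (?r \<union> ?k) = roots + card ?k"
      unfolding roots_def using fin disj by (rule card_Un_disjoint)
    moreover have "card (Range (chain j J)) = length J"
      using partial_matching_card(2)[OF pm] cc by simp
    ultimately show ?thesis using main g False by (simp only: if_False)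
  qed
qed

text \<open>The individual counts depend on where \<open>J\<close> is attached; only the sum over the free vertices \<open>u\<close>
  is uniform in \<open>J\<close>.\<close>

lemma sum_extending_chain:
  assumes J: "distinct J" "set J \<subseteq> C"
  shows "(\<Sum>u\<in>V - last ` C. card {\<sigma> \<in> matchings V V. chain (col u) J \<subseteq> \<sigma> \<and> acyclic (E1 \<sigma>)}) =
    roots * (card V - card C) * fact (card V - length J - 1)"
proof -
  let ?f = "fact (card V - length J - 1) :: nat"
  let ?U = "V - last ` C"
  \<comment> \<open>Vertices are sorted by their contracted column: outside \<open>C\<close>, on
    \<open>J\<close>, or elsewhere in \<open>C\<close>. By the three cases of
    \<open>card_extending_chain\<close>, those in \<open>B\<close> contribute nothing, and the
    summand is constant on \<open>A\<close> and on \<open>D\<close>.\<close>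
  define A where "A = {v \<in> V. g (col v) \<notin> C}"
  define B where "B = {v \<in> V. g (col v) \<in> set J}"
  define D where "D = {v \<in> V. g (col v) \<in> C - set J}"
  let ?N = "\<lambda>u. card {\<sigma> \<in> matchings V V. chain (col u) J \<subseteq> \<sigma> \<and> acyclic (E1 \<sigma>)}"
  have N: "?N u = (if g (col u) \<in> set J then 0 else if g (col u) \<in> C then roots * ?f
      else (roots + card B - length J) * ?f)" if "u \<in> V" for u
    using card_extending_chain[OF J, of "col u"] that colF unfolding B_def by blast
  have fin: "finite A" "finite B" "finite D" using finV by (auto simp: A_def B_def D_def)
  have glast: "g (col (last c)) = c" if "c \<in> C" for c
    using col_last[of c] g_C that CF by auto
  have VABD: "card V = card A + card B + card D"
  proof -
    have "V = A \<union> B \<union> D" using J by (auto simp: A_def B_def D_def)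
    moreover have "A \<inter> B = {}" "(A \<union> B) \<inter> D = {}" using J by (auto simp: A_def B_def D_def)
    ultimately show ?thesis using fin by (simp add: card_Un_disjoint)
  qed
  have kB: "length J \<le> card B"
  proof -
    have "last ` set J \<subseteq> B" using J glast last_CV by (auto simp: B_def)
    moreover have "card (last ` set J) = length J"
      using J inj_on_subset[OF inj_last_C J(2)] by (simp add: card_image distinct_card)
    ultimately show ?thesis using card_mono[OF fin(2)] by metis
  qed
  have lD: "last ` (C - set J) \<subseteq> D" using glast last_CV by (auto simp: D_def)
  have "card (last ` (C - set J)) = card C - length J"
    using J inj_on_subset[OF inj_last_C, of "C - set J"] by (simp add: card_image card_Diff_subset distinct_card)
  then have cD: "card (D - last ` C) = card D - (card C - length J)" "card C - length J \<le> card D"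
  proof -
    have "D \<inter> last ` C \<subseteq> last ` (C - set J)" using glast by (auto simp: D_def)
    then have "D - last ` C = D - last ` (C - set J)" using lD by blast
    then show "card (D - last ` C) = card D - (card C - length J)"
      using lD \<open>card (last ` (C - set J)) = _\<close> fin(3) finite_subset[OF lD fin(3)]
      by (simp add: card_Diff_subset)
    show "card C - length J \<le> card D" using card_mono[OF fin(3) lD] \<open>card (last ` (C - set J)) = _\<close> by simp
  qed
  have JC: "length J \<le> card C" using J finC by (metis card_mono distinct_card)
  have A_U: "A \<subseteq> ?U" using glast by (auto simp: A_def)
  have U: "?U = A \<union> (B - last ` C) \<union> (D - last ` C)"
    using A_U J by (auto simp: A_def B_def D_def)
  have "(\<Sum>u\<in>?U. ?N u) = (\<Sum>u\<in>A. ?N u) + (\<Sum>u\<in>B - last ` C. ?N u) + (\<Sum>u\<in>D - last ` C. ?N u)"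
  proof -
    have "A \<inter> (B - last ` C) = {}" "(A \<union> (B - last ` C)) \<inter> (D - last ` C) = {}"
      using J by (auto simp: A_def B_def D_def)
    then show ?thesis unfolding U using fin by (simp add: sum.union_disjoint)
  qed
  also have "(\<Sum>u\<in>A. ?N u) = (\<Sum>u\<in>A. (roots + card B - length J) * ?f)"
  proof (rule sum.cong[OF refl])
    fix u assume "u \<in> A"
    then have "u \<in> V" "g (col u) \<notin> C" "g (col u) \<notin> set J" using J by (auto simp: A_def)
    then show "?N u = (roots + card B - length J) * ?f" using N by presburger
  qed
  also have "(\<Sum>u\<in>B - last ` C. ?N u) = (\<Sum>u\<in>B - last ` C. 0)"
  proof (rule sum.cong[OF refl])
    fix u assume "u \<in> B - last ` C"
    then have "u \<in> V" "g (col u) \<in> set J" by (auto simp: B_def)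
    then show "?N u = 0" using N by presburger
  qed
  also have "(\<Sum>u\<in>D - last ` C. ?N u) = (\<Sum>u\<in>D - last ` C. roots * ?f)"
  proof (rule sum.cong[OF refl])
    fix u assume "u \<in> D - last ` C"
    then have "u \<in> V" "g (col u) \<in> C" "g (col u) \<notin> set J" by (auto simp: D_def)
    then show "?N u = roots * ?f" using N by presburger
  qed
  finally have "(\<Sum>u\<in>?U. ?N u) =
      roots * ((roots + card B - length J) * ?f) + (card D - (card C - length J)) * (roots * ?f)"
    by (simp add: cD roots_def A_def)
  also have "\<dots> = roots * ((roots + card B - length J) + (card D - (card C - length J))) * ?f"
    by (simp add: algebra_simps)
  \<comment> \<open>Since \<open>card A = roots\<close>, the terms in \<open>length J\<close>
    cancel; this makes the factor uniform in \<open>J\<close>.\<close>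
  also have "(roots + card B - length J) + (card D - (card C - length J)) = card V - card C"
    using VABD kB cD(2) JC unfolding roots_def A_def by linarith
  finally show ?thesis .
qed

text \<open>A core is the part of a matching at the critical vertices of row 1; the first forest depends
  on nothing else.\<close>

definition cores :: "('v \<times> 'v) set set" where
  "cores = {h. partial_matching V V h \<and> Domain h = last ` C \<and> acyclic (E1 h)}"

section \<open>Cores and the second-row paths they force\<close>

lemma finite_cores: "finite cores"
proof (rule finite_subset)
  show "cores \<subseteq> Pow (V \<times> V)" using partial_matching_Times[of V V] by (simp add: cores_def Collect_mono Pow_def)
qed (use finV in simp)

lemma card_core: "h \<in> cores \<Longrightarrow> card h = card C"
  using partial_matching_card(1)[of V V h] card_image[OF inj_last_C] by (simp add: cores_def)

text \<open>Restricting a matching to the rightmost vertices of \<open>C\<close> gives the only core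
  it can contain, and both have the same \<open>E1\<close>. \<open>Q\<close> stands for the second
  forest condition or for containing a chain.\<close>

lemma card_matchings_by_core:
  "card {\<sigma> \<in> matchings V V. Q \<sigma> \<and> acyclic (E1 \<sigma>)} =
    (\<Sum>h\<in>cores. card {\<sigma> \<in> matchings V V. h \<subseteq> \<sigma> \<and> Q \<sigma>})"
proof -
  have E1_eq: "E1 \<sigma> = E1 h"
    if \<sigma>: "\<sigma> \<in> matchings V V" and h: "h \<subseteq> \<sigma>" "Domain h = last ` C" for \<sigma> h
  proof
    have sv: "single_valued \<sigma>" using \<sigma> by (simp add: matchings_def partial_matching_def)
    show "E1 \<sigma> \<subseteq> E1 h"
    proof
      fix e assume "e \<in> E1 \<sigma>"
      then obtain c v where e: "e = (c, g (col v))" "c \<in> C" "(last c, v) \<in> \<sigma>"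
        by (auto simp: step_def)
      then obtain v' where v': "(last c, v') \<in> h" using h(2) by blast
      then have "v' = v" using single_valuedD[OF sv _ e(3)] h(1) by blast
      then show "e \<in> E1 h" using e v' by (auto simp: step_def)
    qed
  qed (rule step_mono[OF h(1)])
  have "{\<sigma> \<in> matchings V V. Q \<sigma> \<and> acyclic (E1 \<sigma>)} =
      (\<Union>h\<in>cores. {\<sigma> \<in> matchings V V. h \<subseteq> \<sigma> \<and> Q \<sigma>})" (is "?L = ?R")
  proof
    show "?L \<subseteq> ?R"
    proof
      fix \<sigma> assume \<sigma>: "\<sigma> \<in> ?L"
      define h where "h = \<sigma> \<inter> last ` C \<times> UNIV"
      have pm: "partial_matching V V \<sigma>" "Domain \<sigma> = V" using \<sigma> by (auto simp: matchings_def)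
      have h: "h \<subseteq> \<sigma>" by (auto simp: h_def)
      have "Domain h = last ` C"
      proof
        show "last ` C \<subseteq> Domain h"
        proof
          fix u assume u: "u \<in> last ` C"
          then have "u \<in> Domain \<sigma>" using pm(2) last_CV by auto
          then show "u \<in> Domain h" using u by (auto simp: h_def)
        qed
      qed (auto simp: h_def)
      then have "h \<in> cores"
        using partial_matching_subset[OF pm(1) h] E1_eq[OF _ h] \<sigma> by (simp add: cores_def)
      then show "\<sigma> \<in> ?R" using \<sigma> h by blast
    qed
    show "?R \<subseteq> ?L"
    proof
      fix \<sigma> assume "\<sigma> \<in> ?R"
      then obtain h where "h \<in> cores" "\<sigma> \<in> matchings V V" "h \<subseteq> \<sigma>" "Q \<sigma>" by blast
      then show "\<sigma> \<in> ?L" using E1_eq[of \<sigma> h] by (simp add: cores_def)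
    qed
  qed
  moreover have "card ?R = (\<Sum>h\<in>cores. card {\<sigma> \<in> matchings V V. h \<subseteq> \<sigma> \<and> Q \<sigma>})"
  proof (rule card_UN_disjoint[OF finite_cores])
    show "\<forall>h\<in>cores. finite {\<sigma> \<in> matchings V V. h \<subseteq> \<sigma> \<and> Q \<sigma>}"
      using finite_matchings[OF finV finV] by simp
    have eq: "h = h'" if "h \<in> cores" "h' \<in> cores" "h \<subseteq> \<sigma>" "h' \<subseteq> \<sigma>" "\<sigma> \<in> matchings V V" for h h' \<sigma>
    proof -
      have sv: "single_valued \<sigma>" using that(5) by (simp add: matchings_def partial_matching_def)
      have "a \<subseteq> b" if ab: "Domain a = Domain b" "a \<subseteq> \<sigma>" "b \<subseteq> \<sigma>" for a b
      proof
        fix e assume e: "e \<in> a"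
        obtain x y where xy: "e = (x, y)" by (cases e)
        then obtain y' where "(x, y') \<in> b" using e ab(1) by blast
        moreover have "y' = y" using single_valuedD[OF sv] calculation e xy ab(2,3) by blast
        ultimately show "e \<in> b" using xy by simp
      qed
      moreover have "Domain h = Domain h'" using that by (simp add: cores_def)
      ultimately show ?thesis using that(3,4) by (metis subset_antisym)
    qed
    show "\<forall>h\<in>cores. \<forall>h'\<in>cores. h \<noteq> h' \<longrightarrow>
      {\<sigma> \<in> matchings V V. h \<subseteq> \<sigma> \<and> Q \<sigma>} \<inter> {\<sigma> \<in> matchings V V. h' \<subseteq> \<sigma> \<and> Q \<sigma>} = {}"
      using eq by blast
  qed
  ultimately show ?thesis by simp
qed

text \<open>An edge of \<open>E2\<close> starting in \<open>C\<close> is a reversed edge of \<open>E1\<close>, so the core's second-row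
  digraph inherits acyclicity from the first row.\<close>

lemma core_E2:
  assumes "h \<in> cores"
  shows "single_valued (E2 {} h)" "Range (E2 {} h) \<subseteq> C"
    "finite (E2 {} h)" "acyclic (E2 {} h)"
proof -
  let ?E = "E2 {} h"
  have h: "partial_matching V V h" "Domain h = last ` C" "acyclic (E1 h)"
    using assms by (auto simp: cores_def)
  show "single_valued ?E" using h(1) by (intro single_valued_step) (simp add: partial_matching_def)
  have edge: "d \<in> F \<and> c \<in> C \<and> (last c, last d) \<in> h" if e: "(d, c) \<in> ?E" for d c
  proof -
    obtain u where u: "d \<in> F" "c = col u" "(u, last d) \<in> h" using e unfolding step_def by blast
    then obtain c' where "c' \<in> C" "u = last c'" using h(2) by blast
    then show ?thesis using u CF col_last[of c'] by auto
  qed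
  then show ran: "Range ?E \<subseteq> C" by blast
  show "finite ?E"
    using partial_matching_finite[OF h(1) finV finV] finF by (intro finite_step) auto
  have rev: "(c, d) \<in> E1 h" if "(d, c) \<in> ?E" "d \<in> C" for c d
  proof -
    have "c \<in> C" "(last c, last d) \<in> h" using edge[OF that(1)] by auto
    then have "(c, g (col (last d))) \<in> E1 h" unfolding step_def by blast
    then show ?thesis using that(2) CF col_last[of d] g_C[of d] by auto
  qed
  show "acyclic ?E"
    unfolding acyclic_def
  proof (intro allI notI)
    fix d assume d: "(d, d) \<in> ?E\<^sup>+"
    \<comment> \<open>A cycle stays inside the range, hence inside \<open>C\<close>, where every
      edge can be reversed into \<open>E1\<close>.\<close>
    have "d \<in> C" using d ran trancl_range[of ?E] by blast
    have "(k, d) \<in> (E1 h)\<^sup>+ \<and> k \<in> C" if "(d, k) \<in> ?E\<^sup>+" for k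
      using that
    proof induction
      case (base k)
      then show ?case using rev[OF base \<open>d \<in> C\<close>] ran by blast
    next
      case (step k k')
      have "(k', k) \<in> E1 h" using rev[OF step(2)] step(3) by blast
      then show ?case using step ran trancl_into_trancl2[of k' k] by blast
    qed
    then have "(d, d) \<in> (E1 h)\<^sup>+" using d by blast
    then show False using h(3) by (simp add: acyclic_def)
  qed
qed

text \<open>\<open>E2 P h\<close> is \<open>E2 {} h\<close> without the edges leaving
  \<open>P\<close>. The orbit of \<open>j\<close> never leaves \<open>F\<close>, so stopping outside
  \<open>F - P\<close> means stopping in \<open>P\<close>; conversely a path can be cut at its first
  column in \<open>P\<close>.\<close>

lemma rooted_E2:
  assumes h: "h \<in> cores" and j: "j \<in> F"
  shows "rooted (F - P) (E2 P h) j \<longleftrightarrow> P \<inter> (E2 {} h)\<^sup>* `` {j} \<noteq> {}"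
proof
  assume "rooted (F - P) (E2 P h) j"
  then obtain k where k: "k \<notin> F - P" "(j, k) \<in> (E2 P h)\<^sup>*" by (auto simp: rooted_def)
  have "E2 P h \<subseteq> E2 {} h" by (auto simp: step_def)
  then have jk: "(j, k) \<in> (E2 {} h)\<^sup>*" using k(2) rtrancl_mono by blast
  then have "k = j \<or> k \<in> Range (E2 {} h)" by (auto elim: rtranclE)
  then have "k \<in> F" using j core_E2(2)[OF h] CF by auto
  then show "P \<inter> (E2 {} h)\<^sup>* `` {j} \<noteq> {}" using k(1) jk by blast
next
  assume "P \<inter> (E2 {} h)\<^sup>* `` {j} \<noteq> {}"
  then obtain k where k: "k \<in> P" "(j, k) \<in> (E2 {} h)\<^sup>*" by blast
  from k(2) show "rooted (F - P) (E2 P h) j"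
  proof (induction rule: converse_rtrancl_induct)
    case base
    then show ?case using k(1) by (auto simp: rooted_def)
  next
    case (step y z)
    show ?case
    proof (cases "y \<in> P")
      case True
      then show ?thesis by (auto simp: rooted_def)
    next
      case False
      then have "(y, z) \<in> E2 P h" using step(1) by (auto simp: step_def)
      then show ?thesis using step(3) unfolding rooted_def by (meson converse_rtrancl_into_rtrancl)
    qed
  qed
qed

text \<open>The count of acyclic completions is applied to the converse of \<open>h\<close>: the
  targets are then vertices of row 1, and the free ones are those outside the domain of
  \<open>h\<close>.\<close>

lemma card_core_extensions:
  assumes h: "h \<in> cores"
  shows "card {\<sigma> \<in> matchings V V. h \<subseteq> \<sigma> \<and> acyclic (E2 P \<sigma>)} =
    card {u \<in> V - last ` C. P \<inter> (E2 {} h)\<^sup>* `` {col u} \<noteq> {}} * fact (card V - card C - 1)"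
proof -
  have pm: "partial_matching V V (h\<inverse>)" "Domain h = last ` C"
    using h by (auto simp: cores_def partial_matching_converse)
  have "E2 P h \<subseteq> E2 {} h" by (auto simp: step_def)
  then have ac: "acyclic (E2 P h)" using core_E2(4)[OF h] acyclic_subset by blast
  have ch: "card (h\<inverse>) = card C" using card_core[OF h] by simp
  have inj: "inj_on last (F - P)" "last ` (F - P) \<subseteq> V"
    using inj_last lastV by (auto intro: inj_on_subset)
  have fin: "finite (F - P)" using finF by simp
  have less: "card (h\<inverse>) < card V" using few ch by simp
  have "{\<sigma> \<in> matchings V V. h \<subseteq> \<sigma> \<and> acyclic (E2 P \<sigma>)} =
      converse ` {\<sigma> \<in> matchings V V. h\<inverse> \<subseteq> \<sigma> \<and> acyclic (step (F - P) last col \<sigma>)}" (is "?L = _ ` ?R")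
  proof
    show "?L \<subseteq> converse ` ?R"
    proof
      fix \<sigma> assume \<sigma>: "\<sigma> \<in> ?L"
      then have "h\<inverse> \<subseteq> \<sigma>\<inverse>" by blast
      then have "\<sigma>\<inverse> \<in> ?R" using \<sigma> by (simp add: matchings_converse)
      then have "(\<sigma>\<inverse>)\<inverse> \<in> converse ` ?R" by (rule imageI)
      then show "\<sigma> \<in> converse ` ?R" by simp
    qed
    show "converse ` ?R \<subseteq> ?L"
    proof
      fix \<sigma> assume "\<sigma> \<in> converse ` ?R"
      then obtain \<tau> where \<tau>: "\<tau> \<in> ?R" "\<sigma> = \<tau>\<inverse>" by blast
      then have "h \<subseteq> \<sigma>" by (simp add: converse_subset_swap)
      then show "\<sigma> \<in> ?L" using \<tau> by (simp add: matchings_converse)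
    qed
  qed
  then have "card ?L = card ?R" by (simp add: card_image inj_on_def)
  also have "\<dots> = card {u \<in> V - Range (h\<inverse>). rooted (F - P) (E2 P h) (col u)} * fact (card V - card C - 1)"
    using card_acyclic_extensions[OF finV finV fin refl inj pm(1) ac less] unfolding ch .
  also have "{u \<in> V - Range (h\<inverse>). rooted (F - P) (E2 P h) (col u)} =
      {u \<in> V - last ` C. P \<inter> (E2 {} h)\<^sup>* `` {col u} \<noteq> {}}"
  proof -
    have "rooted (F - P) (E2 P h) (col u) \<longleftrightarrow> P \<inter> (E2 {} h)\<^sup>* `` {col u} \<noteq> {}" if "u \<in> V" for u
      using that rooted_E2[OF h] colF by blast
    moreover have "Range (h\<inverse>) = last ` C" using pm(2) by simp
    ultimately show ?thesis by blast
  qed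
  finally show ?thesis .
qed

text \<open>Pairs of a core start only at rightmost vertices of columns in \<open>C\<close>, so a
  forced edge from \<open>j\<close> to \<open>a\<close> must come from the pair of
  \<open>last a\<close> and \<open>last j\<close>.\<close>

lemma successively_core:
  assumes h: "h \<in> cores" and j: "j \<in> F"
  shows "successively (\<lambda>x y. (x, y) \<in> E2 {} h) (j # J) \<longleftrightarrow> set J \<subseteq> C \<and> chain j J \<subseteq> h"
  using j
proof (induction j J rule: chain.induct)
  case (2 j a J)
  have "(j, a) \<in> E2 {} h \<longleftrightarrow> a \<in> C \<and> (last a, last j) \<in> h"
  proof
    assume e: "(j, a) \<in> E2 {} h"
    then have a: "a \<in> C" using core_E2(2)[OF h] by blast
    from e obtain u where u: "a = col u" "(u, last j) \<in> h" by (auto simp: step_def)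
    then obtain c where "c \<in> C" "u = last c" using h by (auto simp: cores_def)
    then show "a \<in> C \<and> (last a, last j) \<in> h" using a u CF col_last[of c] by auto
  next
    assume "a \<in> C \<and> (last a, last j) \<in> h"
    then show "(j, a) \<in> E2 {} h" using 2(2) CF col_last[of a] by (force simp: step_def)
  qed
  then show ?case using 2 CF by auto
qed simp

text \<open>Candidates for the columns that follow the start of a forced path with \<open>m\<close>
  edges; the start itself may lie outside \<open>C\<close>.\<close>

definition chains :: "nat \<Rightarrow> 'c list set" where
  "chains m = {J. length J = m \<and> distinct J \<and> set J \<subseteq> C}"

lemma card_chains:
  assumes "m \<le> card C"
  shows "real (card (chains m)) = fact (card C) / fact (card C - m)"
proof -
  have "card (chains m) = \<Prod>{card C - m + 1..card C}"
    using card_lists_distinct_length_eq[OF finC assms] by (simp add: chains_def)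
  also have "real \<dots> = fact (card C) / fact (card C - m)"
  proof -
    have "fact (card C) = fact (card C - m) * \<Prod>{card C - m + 1..card C}"
      using assms prod.ub_add_nat[of 1 "card C - m" "\<lambda>x. x" m] by (simp add: fact_prod)
    then have "fact (card C) = fact (card C - m) * real (\<Prod>{card C - m + 1..card C})"
      by (metis of_nat_fact of_nat_mult)
    then show ?thesis by (simp del: of_nat_prod)
  qed
  finally show ?thesis .
qed

text \<open>The orbit of \<open>j\<close> is a path with at most \<open>card C + 1\<close> columns,
  and it has more than \<open>m\<close> columns exactly if \<open>h\<close> contains a chain of
  length \<open>m\<close> from \<open>j\<close>. So the number of such chains, 0 or 1, tells which
  summands of \<open>card_subsets_meeting\<close> occur.\<close>

lemma card_meeting_orbit:
  assumes h: "h \<in> cores" and j: "j \<in> F" and A: "finite A" "F \<subseteq> A" and R: "R \<ge> 1"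
  shows "card {P. P \<subseteq> A \<and> card P = R \<and> P \<inter> (E2 {} h)\<^sup>* `` {j} \<noteq> {}} =
    (\<Sum>m\<le>card C. ((card A - m - 1) choose (R - 1)) * card {J \<in> chains m. chain j J \<subseteq> h})"
proof -
  let ?O = "(E2 {} h)\<^sup>* `` {j}"
  have sub: "?O \<subseteq> insert j C"
  proof
    fix x assume "x \<in> ?O"
    then have "(j, x) \<in> (E2 {} h)\<^sup>*" by simp
    then show "x \<in> insert j C" by (cases rule: rtranclE) (use core_E2(2)[OF h] in auto)
  qed
  then have "card ?O \<le> card (insert j C)" using finC by (intro card_mono) auto
  also have "\<dots> \<le> Suc (card C)" by (rule card_insert_le_m1) auto
  finally have le: "card ?O \<le> Suc (card C)" .
  have "?O \<subseteq> A" using sub j A(2) CF by blast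
  have one: "card {J \<in> chains m. chain j J \<subseteq> h} = (if m < card ?O then 1 else 0)" for m
  proof -
    have "{J \<in> chains m. chain j J \<subseteq> h} =
        {J. length J = m \<and> successively (\<lambda>x y. (x, y) \<in> E2 {} h) (j # J)}"
      using successively_acyclic_distinct[OF core_E2(4)[OF h]] successively_core[OF h j]
      by (auto simp: chains_def)
    then show ?thesis
      using card_paths_from[OF core_E2(3)[OF h] core_E2(1)[OF h] core_E2(4)[OF h]] by simp
  qed
  have "card {P. P \<subseteq> A \<and> card P = R \<and> P \<inter> ?O \<noteq> {}} =
      (\<Sum>m<card ?O. (card A - m - 1) choose (R - 1))"
    using card_subsets_meeting[OF A(1) \<open>?O \<subseteq> A\<close> R] .
  also have "\<dots> = (\<Sum>m\<le>card C. if m < card ?O then (card A - m - 1) choose (R - 1) else 0)"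
    using le by (intro sum.mono_neutral_cong_left) auto
  also have "\<dots> = (\<Sum>m\<le>card C. ((card A - m - 1) choose (R - 1)) * card {J \<in> chains m. chain j J \<subseteq> h})"
    unfolding one by (intro sum.cong) auto
  finally show ?thesis .
qed

text \<open>For each \<open>u\<close>, the matchings that contain the chain and are acyclic in row 1
  are grouped by core, each core with the chain having \<open>fact (card V - card C)\<close>
  completions; their total over \<open>u\<close> is known from
  \<open>sum_extending_chain\<close>.\<close>

lemma sum_chain_in_cores:
  assumes "J \<in> chains m"
  shows "fact (card V - card C) * (\<Sum>u\<in>V - last ` C. card {h \<in> cores. chain (col u) J \<subseteq> h}) =
    roots * (card V - card C) * fact (card V - m - 1)"
proof -
  have J: "distinct J" "set J \<subseteq> C" "length J = m" using assms by (auto simp: chains_def)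
  have "fact (card V - card C) * card {h \<in> cores. chain j J \<subseteq> h} =
      card {\<sigma> \<in> matchings V V. chain j J \<subseteq> \<sigma> \<and> acyclic (E1 \<sigma>)}" for j
  proof -
    \<comment> \<open>Chain pairs start at rightmost vertices of \<open>C\<close>, where a matching
      agrees with its core.\<close>
    have iff: "chain j J \<subseteq> \<sigma> \<longleftrightarrow> chain j J \<subseteq> h" if "h \<in> cores" "\<sigma> \<in> matchings V V" "h \<subseteq> \<sigma>" for h \<sigma>
    proof
      assume c: "chain j J \<subseteq> \<sigma>"
      have sv: "single_valued \<sigma>" using that(2) by (simp add: matchings_def partial_matching_def)
      show "chain j J \<subseteq> h"
      proof
        fix e assume e: "e \<in> chain j J"
        obtain x y where xy: "e = (x, y)" by (cases e)
        have "x \<in> last ` set J" using e xy Domain_chain[of j J] by blast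
        then have "x \<in> Domain h" using J(2) that(1) by (auto simp: cores_def)
        then obtain y' where y': "(x, y') \<in> h" by blast
        moreover have "y' = y" using single_valuedD[OF sv] y' e xy c that(3) by blast
        ultimately show "e \<in> h" using xy by simp
      qed
    qed (use that in blast)
    have "card {\<sigma> \<in> matchings V V. chain j J \<subseteq> \<sigma> \<and> acyclic (E1 \<sigma>)} =
        (\<Sum>h\<in>cores. card {\<sigma> \<in> matchings V V. h \<subseteq> \<sigma> \<and> chain j J \<subseteq> \<sigma>})"
      using card_matchings_by_core .
    also have "\<dots> = (\<Sum>h\<in>cores. if chain j J \<subseteq> h then fact (card V - card C) else 0)"
    proof (rule sum.cong[OF refl])
      fix h assume h: "h \<in> cores"
      have "{\<sigma> \<in> matchings V V. h \<subseteq> \<sigma> \<and> chain j J \<subseteq> \<sigma>} =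
          (if chain j J \<subseteq> h then {\<sigma> \<in> matchings V V. h \<subseteq> \<sigma>} else {})"
        using iff[OF h] by auto
      moreover have "card {\<sigma> \<in> matchings V V. h \<subseteq> \<sigma>} = fact (card V - card C)"
        using card_matchings_extending[OF finV finV refl, of h] h card_core[OF h] by (simp add: cores_def)
      ultimately show "card {\<sigma> \<in> matchings V V. h \<subseteq> \<sigma> \<and> chain j J \<subseteq> \<sigma>} =
          (if chain j J \<subseteq> h then fact (card V - card C) else 0)" by simp
    qed
    also have "\<dots> = fact (card V - card C) * card {h \<in> cores. chain j J \<subseteq> h}"
      using finite_cores by (simp add: sum.If_cases Int_def)
    finally show ?thesis by simp
  qed
  then show ?thesis using sum_extending_chain[OF J(1,2)] J(3) by (simp add: sum_distrib_left)
qed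

lemma finite_chains: "finite (chains m)"
proof (rule finite_subset)
  show "chains m \<subseteq> {J. set J \<subseteq> C \<and> length J = m}" by (auto simp: chains_def)
qed (rule finite_lists_length_eq[OF finC])

text \<open>Two exchanges of summation: for each core, count the sets \<open>P\<close> meeting the
  orbit of a free vertex instead of the free vertices for each \<open>P\<close>; then count the
  cores containing a given chain instead of the chains inside a given core.\<close>

theorem sum_card_forest_matchings:
  assumes A: "finite A" "F \<subseteq> A" and R: "R \<ge> 1"
  shows "(\<Sum>P | P \<subseteq> A \<and> card P = R.
      card {\<sigma> \<in> matchings V V. acyclic (E2 P \<sigma>) \<and> acyclic (E1 \<sigma>)}) =
    roots * (\<Sum>m\<le>card C. ((card A - m - 1) choose (R - 1)) * card (chains m) * fact (card V - m - 1))"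
    (is "?N = _")
proof -
  let ?U = "V - last ` C" and ?Ps = "{P. P \<subseteq> A \<and> card P = R}"
  let ?d = "card V - card C"
  let ?O = "\<lambda>h u. (E2 {} h)\<^sup>* `` {col u}"
  let ?b = "\<lambda>m. (card A - m - 1) choose (R - 1)"
  have finP: "finite ?Ps" using A(1) by simp
  have finU: "finite ?U" using finV by simp
  have colU: "col u \<in> F" if "u \<in> ?U" for u using that colF by blast
  have "?N = (\<Sum>P\<in>?Ps. \<Sum>h\<in>cores. card {u \<in> ?U. P \<inter> ?O h u \<noteq> {}} * fact (?d - 1))"
    by (intro sum.cong refl) (simp add: card_matchings_by_core card_core_extensions)
  also have "\<dots> = fact (?d - 1) * (\<Sum>P\<in>?Ps. \<Sum>h\<in>cores. card {u \<in> ?U. P \<inter> ?O h u \<noteq> {}})"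
    by (simp add: sum_distrib_left mult.commute)
  also have "(\<Sum>P\<in>?Ps. \<Sum>h\<in>cores. card {u \<in> ?U. P \<inter> ?O h u \<noteq> {}}) =
      (\<Sum>h\<in>cores. \<Sum>P\<in>?Ps. card {u \<in> ?U. P \<inter> ?O h u \<noteq> {}})"
    by (rule sum.swap)
  also have "\<dots> = (\<Sum>h\<in>cores. \<Sum>u\<in>?U. card {P \<in> ?Ps. P \<inter> ?O h u \<noteq> {}})"
    using finP finU by (intro sum.cong refl sum_multicount_gen) auto
  also have "\<dots> = (\<Sum>h\<in>cores. \<Sum>u\<in>?U. \<Sum>m\<le>card C. ?b m * card {J \<in> chains m. chain (col u) J \<subseteq> h})"
  proof (intro sum.cong refl)
    fix h u assume "h \<in> cores" "u \<in> ?U"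
    then show "card {P \<in> ?Ps. P \<inter> ?O h u \<noteq> {}} =
        (\<Sum>m\<le>card C. ?b m * card {J \<in> chains m. chain (col u) J \<subseteq> h})"
      using card_meeting_orbit[OF _ colU A R] by (simp add: conj_assoc)
  qed
  also have "\<dots> = (\<Sum>m\<le>card C. \<Sum>u\<in>?U. \<Sum>h\<in>cores. ?b m * card {J \<in> chains m. chain (col u) J \<subseteq> h})"
    by (subst sum.swap, subst (2) sum.swap, subst sum.swap) (rule refl)
  also have "\<dots> = (\<Sum>m\<le>card C. ?b m * (\<Sum>u\<in>?U. \<Sum>J\<in>chains m. card {h \<in> cores. chain (col u) J \<subseteq> h}))"
  proof -
    have "(\<Sum>h\<in>cores. card {J \<in> chains m. chain j J \<subseteq> h}) =
        (\<Sum>J\<in>chains m. card {h \<in> cores. chain j J \<subseteq> h})" for m j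
      using finite_cores finite_chains by (intro sum_multicount_gen) auto
    then show ?thesis by (simp flip: sum_distrib_left)
  qed
  also have "\<dots> = (\<Sum>m\<le>card C. ?b m * (\<Sum>J\<in>chains m. \<Sum>u\<in>?U. card {h \<in> cores. chain (col u) J \<subseteq> h}))"
    by (subst sum.swap) (rule refl)
  finally have N: "?N = fact (?d - 1) *
      (\<Sum>m\<le>card C. ?b m * (\<Sum>J\<in>chains m. \<Sum>u\<in>?U. card {h \<in> cores. chain (col u) J \<subseteq> h}))" .
  have d: "?d > 0" using few by simp
  \<comment> \<open>\<open>sum_chain_in_cores\<close> carries the factor \<open>fact ?d\<close>, so
    the equation is multiplied by \<open>?d\<close>, which is cancelled at the end.\<close>
  then have "fact ?d = ?d * (fact (?d - 1) :: nat)" by (metis fact_reduce of_nat_id)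
  then have "?d * ?N = fact ?d *
      (\<Sum>m\<le>card C. ?b m * (\<Sum>J\<in>chains m. \<Sum>u\<in>?U. card {h \<in> cores. chain (col u) J \<subseteq> h}))"
    unfolding N by simp
  also have "\<dots> = (\<Sum>m\<le>card C. ?b m *
      (\<Sum>J\<in>chains m. fact ?d * (\<Sum>u\<in>?U. card {h \<in> cores. chain (col u) J \<subseteq> h})))"
    by (simp only: sum_distrib_left mult.left_commute)
  also have "\<dots> = (\<Sum>m\<le>card C. ?b m * (\<Sum>J\<in>chains m. roots * ?d * fact (card V - m - 1)))"
    by (simp only: sum_chain_in_cores cong: sum.cong)
  also have "\<dots> = ?d * (roots * (\<Sum>m\<le>card C. ?b m * card (chains m) * fact (card V - m - 1)))"
    by (simp add: sum_distrib_left mult_ac)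
  finally show ?thesis using d by simp
qed

end

section \<open>Arrowed arrays of an admissible substructure\<close>

text \<open>In a functional digraph a column on a cycle reaches only columns that lead back to it,
  whereas a root has no outgoing edge. Conversely, a path in a finite acyclic digraph stops, and by
  \<open>ran\<close> it can only stop in \<open>R\<close>.\<close>

lemma forest_iff_acyclic:
  assumes fin: "finite (dom f)" and disj: "dom f \<inter> R = {}" and ran: "ran f \<subseteq> dom f \<union> R"
  shows "(\<forall>j\<in>dom f. \<exists>t\<ge>1. \<exists>k\<in>R. (j, k) \<in> Map.graph f ^^ t) \<longleftrightarrow> acyclic (Map.graph f)"
proof -
  let ?G = "Map.graph f"
  have Dom: "Domain ?G = dom f" by (auto simp: graph_def)
  have Ran: "Range ?G = ran f" by (auto simp: graph_def ran_def)
  have sv: "single_valued ?G" by (auto simp: graph_def single_valued_def)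
  have finG: "finite ?G" using fin by (simp add: finite_graph_iff_finite_dom)
  have pow: "(\<exists>t\<ge>1. \<exists>k\<in>R. (j, k) \<in> ?G ^^ t) \<longleftrightarrow> (\<exists>k\<in>R. (j, k) \<in> ?G\<^sup>+)" for j
    by (auto simp: trancl_power Suc_le_eq)
  have "(\<forall>j\<in>dom f. \<exists>k\<in>R. (j, k) \<in> ?G\<^sup>+) \<longleftrightarrow> acyclic ?G"
  proof
    assume root: "\<forall>j\<in>dom f. \<exists>k\<in>R. (j, k) \<in> ?G\<^sup>+"
    show "acyclic ?G"
      unfolding acyclic_def
    proof (intro allI notI)
      fix j assume j: "(j, j) \<in> ?G\<^sup>+"
      then have "j \<in> Domain ?G" using trancl_domain[of ?G] by blast
      then obtain k where k: "k \<in> R" "(j, k) \<in> ?G\<^sup>+" using root Dom by blast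
      have "(k, j) \<in> ?G\<^sup>*"
      proof -
        have "(z, j) \<in> ?G\<^sup>+" if "(j, z) \<in> ?G\<^sup>*" for z
          using that
        proof induction
          case (step y z)
          obtain y' where "(y, y') \<in> ?G" "(y', j) \<in> ?G\<^sup>*" using tranclD[OF step(3)] by blast
          then have "(z, j) \<in> ?G\<^sup>*" using single_valuedD[OF sv step(2)] by blast
          then show ?case using j by (rule rtrancl_trancl_trancl)
        qed (rule j)
        then show ?thesis using k(2) by (simp add: trancl_into_rtrancl)
      qed
      moreover have "k \<notin> Domain ?G" using k(1) disj Dom by blast
      ultimately have "k = j" by (meson DomainI converse_rtranclE)
      then show False using \<open>j \<in> Domain ?G\<close> \<open>k \<notin> Domain ?G\<close> by blast
    qed
  next
    assume ac: "acyclic ?G"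
    show "\<forall>j\<in>dom f. \<exists>k\<in>R. (j, k) \<in> ?G\<^sup>+"
    proof
      fix j assume j: "j \<in> dom f"
      obtain k where k: "k \<notin> Domain ?G" "(j, k) \<in> ?G\<^sup>*"
        using terminal_exists[OF finG ac] by blast
      then have "j \<noteq> k" using j Dom by blast
      then have jk: "(j, k) \<in> ?G\<^sup>+" using k(2) by (simp add: rtrancl_eq_or_trancl)
      then have "k \<in> Range ?G" using trancl_range[of ?G] by blast
      then have "k \<in> R" using Ran ran k(1) Dom by blast
      then show "\<exists>k\<in>R. (j, k) \<in> ?G\<^sup>+" using jk by blast
    qed
  qed
  then show ?thesis unfolding pow .
qed

section \<open>Contraction of arrows\<close>

definition contract :: "('c \<rightharpoonup> 'c) \<Rightarrow> 'c \<Rightarrow> 'c" where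
  "contract \<phi> j = (case \<phi> j of None \<Rightarrow> j | Some k \<Rightarrow> k)"

text \<open>An arrow leads from outside \<open>C\<close> into \<open>C\<close>, so a column with an
  arrow-tail can be bypassed. Every cycle meets \<open>C\<close>, since arrow-heads lie there, and
  cycles through \<open>C\<close> survive the contraction.\<close>

lemma acyclic_contract:
  assumes C: "dom \<phi> \<inter> C = {}" "ran \<phi> \<subseteq> C"
  shows "acyclic (Map.graph \<phi> \<union> step C l \<rho> \<sigma>) \<longleftrightarrow> acyclic (step C l (\<lambda>v. contract \<phi> (\<rho> v)) \<sigma>)"
    (is "acyclic ?G \<longleftrightarrow> acyclic ?S")
proof -
  have c: "contract \<phi> b = b" if "b \<in> C" for b
    using that C(1) by (auto simp: contract_def split: option.splits)
  have arrow: "a \<notin> C" "b \<in> C" "contract \<phi> a = b" if "(a, b) \<in> Map.graph \<phi>" for a b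
    using that C by (auto simp: graph_def contract_def ran_def)
  have S: "?S \<subseteq> ?G\<^sup>+"
  proof
    fix e assume "e \<in> ?S"
    then obtain a v where a: "e = (a, contract \<phi> (\<rho> v))" "a \<in> C" "(l a, v) \<in> \<sigma>" by (auto simp: step_def)
    then have 1: "(a, \<rho> v) \<in> ?G" by (auto simp: step_def)
    show "e \<in> ?G\<^sup>+"
    proof (cases "\<phi> (\<rho> v)")
      case None
      then show ?thesis using 1 a by (auto simp: contract_def)
    next
      case (Some k)
      then have "(\<rho> v, k) \<in> ?G" by (simp add: graph_def)
      then show ?thesis using 1 a Some by (auto simp: contract_def intro: trancl_into_trancl)
    qed
  qed
  have edge: "(a, contract \<phi> b) \<in> ?S" if "(a, b) \<in> ?G" "a \<in> C" for a b
    using that arrow(1)[of a b] by (auto simp: step_def)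
  have arrow_edge: "contract \<phi> a = b \<and> b \<in> C" if "(a, b) \<in> ?G" "a \<notin> C" for a b
    using that arrow[of a b] by (auto simp: step_def)
  \<comment> \<open>The end of the path is contracted as well, so a step along an arrow leaves the
    claim unchanged.\<close>
  have path: "(a, contract \<phi> b) \<in> ?S\<^sup>+" if "(a, b) \<in> ?G\<^sup>+" "a \<in> C" for a b
    using that
  proof (induction rule: trancl_induct)
    case (base b)
    then show ?case using edge by blast
  next
    case (step b b')
    show ?case
    proof (cases "b \<in> C")
      case True
      then have "(b, contract \<phi> b') \<in> ?S" using edge step(2) by blast
      then show ?thesis using step c[OF True] by (auto intro: trancl_into_trancl)
    next
      case False
      then have "contract \<phi> b' = contract \<phi> b" using arrow_edge[OF step(2)] c by auto
      then show ?thesis using step by simp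
    qed
  qed
  show ?thesis
  proof
    assume ac: "acyclic ?G"
    have "?S\<^sup>+ \<subseteq> ?G\<^sup>+" using trancl_mono_subset[OF S] by simp
    then show "acyclic ?S" using ac by (auto simp: acyclic_def)
  next
    assume ac: "acyclic ?S"
    have no: "(a, a) \<notin> ?G\<^sup>+" if "a \<in> C" for a
      using path[of a a] that c[OF that] ac by (auto simp: acyclic_def)
    show "acyclic ?G"
      unfolding acyclic_def
    proof (intro allI notI)
      fix a assume a: "(a, a) \<in> ?G\<^sup>+"
      then obtain b where b: "(a, b) \<in> ?G" "(b, a) \<in> ?G\<^sup>*" by (meson tranclD)
      then have "a \<notin> C" using no a by blast
      then have "b \<in> C" using arrow_edge b(1) by blast
      moreover have "(b, b) \<in> ?G\<^sup>+" using b(2,1) by (rule rtrancl_into_trancl1)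
      ultimately show False using no by blast
    qed
  qed
qed

text \<open>The path from \<open>c\<close> has to stop outside \<open>C\<close>, and it stops at the
  column of some target. This excludes every array when \<open>r = 0\<close>.\<close>

lemma acyclic_step_imp_target_outside:
  assumes fin: "finite V" "finite C" and c: "c \<in> C" and l: "l ` C \<subseteq> V"
    and \<sigma>: "\<sigma> \<in> matchings V V" and ac: "acyclic (step C l \<rho> \<sigma>)"
  shows "\<exists>v\<in>V. \<rho> v \<notin> C"
proof -
  have pm: "partial_matching V V \<sigma>" "Domain \<sigma> = V" using \<sigma> by (auto simp: matchings_def)
  have "finite (step C l \<rho> \<sigma>)"
    using fin(2) partial_matching_finite[OF pm(1) fin(1) fin(1)] by (rule finite_step)
  then obtain k where k: "k \<notin> Domain (step C l \<rho> \<sigma>)" "(c, k) \<in> (step C l \<rho> \<sigma>)\<^sup>*"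
    using terminal_exists[OF _ ac] by blast
  have D: "Domain (step C l \<rho> \<sigma>) = C" using pm(2) l by (auto simp: Domain_step)
  then have "k \<noteq> c" using k c by blast
  then have "k \<in> Range (step C l \<rho> \<sigma>)" using k(2) by (metis RangeI rtranclE)
  then obtain a v where "k = \<rho> v" "(l a, v) \<in> \<sigma>" unfolding step_def by blast
  moreover have "v \<in> V" using \<open>(l a, v) \<in> \<sigma>\<close> partial_matching_Times[OF pm(1)] by blast
  ultimately show ?thesis using k D by blast
qed

lemma matchings_iff_unique_partners:
  "\<sigma> \<in> matchings U X \<longleftrightarrow> \<sigma> \<subseteq> U \<times> X \<and>
    (\<forall>u\<in>U. \<exists>!x. (u, x) \<in> \<sigma>) \<and> (\<forall>x\<in>X. \<exists>!u. (u, x) \<in> \<sigma>)" (is "?L \<longleftrightarrow> ?R")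
proof
  assume ?L
  then have pm: "partial_matching U X \<sigma>" "Domain \<sigma> = U" "Range \<sigma> = X" by (auto simp: matchings_def)
  then have sv: "single_valued \<sigma>" "single_valued (\<sigma>\<inverse>)" by (auto simp: partial_matching_def)
  show ?R
  proof (intro conjI ballI)
    show "\<sigma> \<subseteq> U \<times> X" using partial_matching_Times[OF pm(1)] .
    show "\<exists>!x. (u, x) \<in> \<sigma>" if "u \<in> U" for u
      using that pm(2) single_valuedD[OF sv(1)] by blast
    show "\<exists>!u. (u, x) \<in> \<sigma>" if "x \<in> X" for x
      using that pm(3) single_valuedD[OF sv(2)] by blast
  qed
next
  assume R: ?R
  have "single_valued \<sigma>" "single_valued (\<sigma>\<inverse>)" unfolding single_valued_def using R by blast+
  moreover have "Domain \<sigma> = U" "Range \<sigma> = X" using R by blast+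
  ultimately show ?L by (simp add: matchings_def partial_matching_def)
qed

section \<open>Admissible substructures as sets of matchings\<close>

locale admissible_substructure =
  fixes K R1 s :: nat and w :: "nat \<Rightarrow> nat" and \<R> :: "nat set" and \<phi> :: "nat \<rightharpoonup> nat"
  assumes data: "substructure_data K R1 s w \<R> \<phi>" and adm: "admissible_sub w \<R> \<phi>"
begin

abbreviation "V \<equiv> {(j, p). j \<in> {1..K} \<and> p \<in> {1..w j}}"
abbreviation "F \<equiv> {j \<in> {1..K}. w j \<ge> 1}"
abbreviation "C \<equiv> critical_cols K w \<R> \<phi>"
abbreviation "end_vertex \<equiv> (\<lambda>j. (j, w j))"

lemma dataD: "(\<Sum>j=1..K. w j) = s" "\<R> \<subseteq> {1..K}" "card \<R> = R1" "dom \<phi> \<subseteq> {1..K} - \<R>"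
  using data by (auto simp: substructure_data_def)

text \<open>Admissibility enters here; it is what allows \<open>acyclic_contract\<close> to remove
  the arrows.\<close>

lemma arrow_heads_critical: "ran \<phi> \<subseteq> C"
proof
  fix k assume "k \<in> ran \<phi>"
  then obtain j where j: "\<phi> j = Some k" by (auto simp: ran_def)
  then have "j \<in> dom \<phi>" by blast
  then have "the (\<phi> j) \<notin> \<R> \<union> dom \<phi>" "w (the (\<phi> j)) \<ge> 1"
    using adm unfolding admissible_sub_def irreducible_sub_def by blast+
  then have "k \<notin> \<R> \<union> dom \<phi>" "w k \<ge> 1" by (simp_all add: j)
  moreover have "k \<in> {1..K}" using data \<open>k \<in> ran \<phi>\<close> by (auto simp: substructure_data_def)
  ultimately show "k \<in> C" by (simp add: critical_cols_def)
qed

lemma C_iff: "j \<in> C \<longleftrightarrow> j \<in> F \<and> j \<notin> \<R> \<and> j \<notin> dom \<phi>"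
  by (auto simp: critical_cols_def)

lemma V_Sigma: "V = Sigma {1..K} (\<lambda>j. {1..w j})"
  by auto

lemma finite_V: "finite V"
  unfolding V_Sigma by simp

lemma card_V: "card V = s"
  unfolding V_Sigma using dataD(1) by simp

text \<open>An arrow-head is critical, and a nonempty column without an arrow-tail fails to be
  critical only if it is marked.\<close>

lemma contract_not_C_iff:
  assumes "j \<in> F"
  shows "contract \<phi> j \<notin> C \<longleftrightarrow> j \<in> \<R>"
proof (cases "j \<in> dom \<phi>")
  case True
  then obtain k where "\<phi> j = Some k" by blast
  then show ?thesis using arrow_heads_critical dataD(4) True by (auto simp: contract_def ran_def)
next
  case False
  then have "contract \<phi> j = j" by (auto simp: contract_def split: option.splits)
  then show ?thesis using assms False by (simp add: C_iff)
qed

lemma card_root_vertices: "card {v \<in> V. contract \<phi> (fst v) \<notin> C} = (\<Sum>j\<in>\<R>. w j)"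
proof -
  have "contract \<phi> (fst v) \<notin> C \<longleftrightarrow> fst v \<in> \<R>" if "v \<in> V" for v
    using that by (intro contract_not_C_iff) auto
  then have "{v \<in> V. contract \<phi> (fst v) \<notin> C} = {v \<in> V. fst v \<in> \<R>}" by blast
  also have "\<dots> = Sigma \<R> (\<lambda>j. {1..w j})" using dataD(2) by auto
  finally show ?thesis using finite_subset[OF dataD(2)] by simp
qed

lemma end_vertex_C: "end_vertex ` C \<subseteq> V"
  by (auto simp: critical_cols_def)

lemma contract_C: "c \<in> C \<Longrightarrow> contract \<phi> c = c"
  by (auto simp: C_iff contract_def split: option.splits)

text \<open>The strict bound \<open>few\<close> comes from \<open>r > 0\<close>: some vertex lies in
  a marked column of row 1, and no such vertex is the rightmost vertex of a column in
  \<open>C\<close>.\<close>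

lemma two_rows_columns:
  assumes "(\<Sum>j\<in>\<R>. w j) > 0"
  shows "two_rows V F C end_vertex fst (contract \<phi>)"
proof
  let ?A = "{v \<in> V. contract \<phi> (fst v) \<notin> C}"
  show "card C < card V"
  proof -
    have "contract \<phi> (fst v) \<in> C" if "v \<in> end_vertex ` C" for v using that contract_C by auto
    then have "end_vertex ` C \<subseteq> V - ?A" using end_vertex_C by blast
    then have "card (end_vertex ` C) \<le> card (V - ?A)" using finite_V by (intro card_mono) auto
    also have "card (V - ?A) = card V - card ?A" using finite_V by (intro card_Diff_subset) auto
    finally have "card (end_vertex ` C) \<le> card V - card ?A" .
    moreover have "card ?A \<le> card V" using finite_V by (intro card_mono) auto
    moreover have "card (end_vertex ` C) = card C" by (intro card_image inj_onI) simp
    ultimately show ?thesis using assms unfolding card_root_vertices by linarith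
  qed
qed (use finite_V contract_C in \<open>auto simp: C_iff\<close>)

text \<open>The data left open by the substructure are the marked columns of row 2 and the pairing.
  Cell sizes are 0 outside the grid, as \<open>is_varray\<close> demands.\<close>

definition array_of :: "nat set \<times> (vertex \<times> vertex) set \<Rightarrow> arrowed" where
  "array_of = (\<lambda>(P, \<sigma>). (\<lparr>cnt = (\<lambda>i j. if j \<in> {1..K} then w j else 0),
     mark = (\<lambda>i. case i of Row1 \<Rightarrow> \<R> | Row2 \<Rightarrow> P), pairing = \<sigma>\<rparr>, \<phi>))"

text \<open>The digraphs are stated outside \<open>two_rows\<close>, whose instance is obtained only
  for \<open>r > 0\<close>, so that they also serve the case \<open>r = 0\<close>.\<close>

definition E1 :: "(vertex \<times> vertex) set \<Rightarrow> (nat \<times> nat) set" where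
  "E1 \<sigma> = step C end_vertex (\<lambda>v. contract \<phi> (fst v)) \<sigma>"

definition E2 :: "nat set \<Rightarrow> (vertex \<times> vertex) set \<Rightarrow> (nat \<times> nat) set" where
  "E2 P \<sigma> = step (F - P) end_vertex fst (\<sigma>\<inverse>)"

text \<open>Every value of \<open>psi\<close> lies in its domain or is a marked column, so
  \<open>forest_iff_acyclic\<close> applies to both rows. In row 1 the graph consists of arrows and
  steps, and the arrows are contracted.\<close>

lemma forest_condition_array_of:
  assumes \<sigma>: "\<sigma> \<in> matchings V V" and P: "P \<subseteq> {1..K}"
  shows "forest_condition (array_of (P, \<sigma>)) \<longleftrightarrow> acyclic (E2 P \<sigma>) \<and> acyclic (E1 \<sigma>)"
proof -
  let ?a = "array_of (P, \<sigma>)"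
  have u1: "\<exists>!v. (u, v) \<in> \<sigma>" and u2: "\<exists>!v. (v, u) \<in> \<sigma>" if "u \<in> V" for u
    using \<sigma> that unfolding matchings_iff_unique_partners by blast+
  have sub: "\<sigma> \<subseteq> V \<times> V" using \<sigma> unfolding matchings_iff_unique_partners by blast
  have eV: "end_vertex j \<in> V" if "j \<in> F" for j using that by auto
  have the1: "(THE v. (u, v) \<in> \<sigma>) = v" if "(u, v) \<in> \<sigma>" for u v
    using that u1[of u] sub by (intro the1_equality) auto
  have the2: "(THE v. (v, u) \<in> \<sigma>) = v" if "(v, u) \<in> \<sigma>" for u v
    using that u2[of u] sub by (intro the1_equality) auto
  have ne: "nonempty_cols (fst ?a) i = F" for i
    by (auto simp: nonempty_cols_def array_of_def)
  have psi1: "psi ?a Row1 j = (if j \<in> dom \<phi> then \<phi> j else if j \<in> C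
      then Some (fst (THE v. (end_vertex j, v) \<in> \<sigma>)) else None)" for j
    using dataD(4) by (auto simp: array_of_def nonempty_cols_def rightmost_def critical_cols_def)
  have psi2: "psi ?a Row2 j = (if j \<in> F - P then Some (fst (THE v. (v, end_vertex j) \<in> \<sigma>)) else None)" for j
    by (auto simp: array_of_def nonempty_cols_def rightmost_def)
  have g1: "Map.graph (psi ?a Row1) = Map.graph \<phi> \<union> step C end_vertex fst \<sigma>"
  proof (rule set_eqI)
    fix e :: "nat \<times> nat"
    obtain j k where e: "e = (j, k)" by (cases e)
    have "(\<exists>x. (end_vertex j, x) \<in> \<sigma> \<and> k = fst x) \<longleftrightarrow> k = fst (THE v. (end_vertex j, v) \<in> \<sigma>)" if "j \<in> C"
    proof -
      have "j \<in> F" using that C_iff by blast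
      then obtain v where v: "(end_vertex j, v) \<in> \<sigma>" using u1[OF eV] by blast
      then have "x = v" if "(end_vertex j, x) \<in> \<sigma>" for x using the1[OF v] the1[OF that] by simp
      then show ?thesis unfolding the1[OF v] using v by blast
    qed
    then show "e \<in> Map.graph (psi ?a Row1) \<longleftrightarrow> e \<in> Map.graph \<phi> \<union> step C end_vertex fst \<sigma>"
      using C_iff[of j] unfolding e graph_def step_def psi1 by auto
  qed
  have g2: "Map.graph (psi ?a Row2) = E2 P \<sigma>"
  proof (rule set_eqI)
    fix e :: "nat \<times> nat"
    obtain j k where e: "e = (j, k)" by (cases e)
    have "(\<exists>x. (x, end_vertex j) \<in> \<sigma> \<and> k = fst x) \<longleftrightarrow> k = fst (THE v. (v, end_vertex j) \<in> \<sigma>)" if j: "j \<in> F"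
    proof -
      obtain v where v: "(v, end_vertex j) \<in> \<sigma>" using u2[OF eV[OF j]] by blast
      then have "x = v" if "(x, end_vertex j) \<in> \<sigma>" for x using the2[OF v] the2[OF that] by simp
      then show ?thesis unfolding the2[OF v] using v by blast
    qed
    then show "e \<in> Map.graph (psi ?a Row2) \<longleftrightarrow> e \<in> E2 P \<sigma>"
      unfolding e graph_def E2_def step_def psi2 by auto
  qed
  have fstF: "fst x \<in> F" if "x \<in> V" for x using that by auto
  have d1: "dom (psi ?a Row1) = dom \<phi> \<union> C" by (auto simp: psi1 dom_def simp del: psi.simps)
  have d2: "dom (psi ?a Row2) = F - P" by (auto simp: psi2 dom_def simp del: psi.simps)
  have ran_graph: "ran f = Range (Map.graph f)" for f :: "nat \<rightharpoonup> nat" by (auto simp: graph_def ran_def)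
  have stepF: "Range (step D end_vertex fst \<tau>) \<subseteq> F" if \<tau>: "\<tau> \<subseteq> V \<times> V" for D \<tau>
  proof
    fix k assume "k \<in> Range (step D end_vertex fst \<tau>)"
    then obtain u v where "(u, v) \<in> \<tau>" "k = fst v" unfolding step_def by blast
    then show "k \<in> F" using \<tau> fstF by blast
  qed
  have fin: "finite (dom \<phi> \<union> C)" "finite (F - P)"
    using finite_subset[OF dataD(4)] by (auto simp: critical_cols_def)
  have r1: "ran (psi ?a Row1) \<subseteq> dom (psi ?a Row1) \<union> \<R>"
  proof -
    have "ran (psi ?a Row1) \<subseteq> ran \<phi> \<union> F"
      using stepF[OF sub, of C] unfolding ran_graph g1 by blast
    also have "\<dots> \<subseteq> dom \<phi> \<union> C \<union> \<R>" using arrow_heads_critical C_iff by blast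
    finally show ?thesis unfolding d1 .
  qed
  have r2: "ran (psi ?a Row2) \<subseteq> dom (psi ?a Row2) \<union> P"
  proof -
    have "\<sigma>\<inverse> \<subseteq> V \<times> V" using sub by blast
    then have "ran (psi ?a Row2) \<subseteq> F" using stepF unfolding ran_graph g2 E2_def by blast
    then show ?thesis unfolding d2 by blast
  qed
  have f1: "(\<forall>j\<in>dom (psi ?a Row1). \<exists>t\<ge>1. \<exists>k\<in>\<R>. (j, k) \<in> Map.graph (psi ?a Row1) ^^ t) \<longleftrightarrow>
      acyclic (E1 \<sigma>)"
  proof -
    have "dom \<phi> \<inter> C = {}" using C_iff by blast
    then have "acyclic (Map.graph (psi ?a Row1)) \<longleftrightarrow> acyclic (E1 \<sigma>)"
      unfolding g1 E1_def using arrow_heads_critical by (rule acyclic_contract)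
    moreover have "dom (psi ?a Row1) \<inter> \<R> = {}" unfolding d1 using dataD(4) C_iff by blast
    ultimately show ?thesis using forest_iff_acyclic[of "psi ?a Row1" \<R>] r1 fin(1) d1 by simp
  qed
  have f2: "(\<forall>j\<in>dom (psi ?a Row2). \<exists>t\<ge>1. \<exists>k\<in>P. (j, k) \<in> Map.graph (psi ?a Row2) ^^ t) \<longleftrightarrow>
      acyclic (E2 P \<sigma>)"
  proof -
    have "dom (psi ?a Row2) \<inter> P = {}" unfolding d2 by blast
    then show ?thesis using forest_iff_acyclic[of "psi ?a Row2" P] r2 fin(2) d2 g2 by simp
  qed
  have all: "(\<forall>i. Q i) \<longleftrightarrow> Q Row1 \<and> Q Row2" for Q by (metis row.exhaust)
  have m: "mark (fst ?a) Row1 = \<R>" "mark (fst ?a) Row2 = P" by (auto simp: array_of_def)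
  show ?thesis unfolding forest_condition_def all m f1 f2 by blast
qed

lemma substructure_eq:
  "substructure K R1 R2 s w \<R> \<phi> = array_of `
    (SIGMA P:{P. P \<subseteq> {1..K} \<and> card P = R2}.
      {\<sigma> \<in> matchings V V. acyclic (E2 P \<sigma>) \<and> acyclic (E1 \<sigma>)})" (is "_ = array_of ` ?S")
proof -
  have vert: "vertices K (fst (array_of x)) i = V" for x i
    by (cases x) (auto simp: vertices_def array_of_def)
  have in_sub: "array_of (P, \<sigma>) \<in> substructure K R1 R2 s w \<R> \<phi> \<longleftrightarrow> (P, \<sigma>) \<in> ?S" for P \<sigma>
  proof -
    have "is_varray K R1 R2 s (fst (array_of (P, \<sigma>))) \<longleftrightarrow>
        P \<subseteq> {1..K} \<and> card P = R2 \<and> \<sigma> \<in> matchings V V"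
      unfolding is_varray_def vert matchings_iff_unique_partners
      using dataD by (auto simp: array_of_def split: row.splits)
    then show ?thesis
      using forest_condition_array_of[of \<sigma> P] data
      by (auto simp: substructure_def AR_def substructure_data_def array_of_def)
  qed
  have surj: "\<exists>P \<sigma>. a = array_of (P, \<sigma>)" if "a \<in> substructure K R1 R2 s w \<R> \<phi>" for a
  proof -
    obtain \<alpha> \<phi>' where "a = (\<alpha>, \<phi>')" by (cases a)
    then have a: "a = (\<alpha>, \<phi>)" "is_varray K R1 R2 s \<alpha>" "mark \<alpha> Row1 = \<R>"
        "\<forall>i. \<forall>j\<in>{1..K}. cnt \<alpha> i j = w j"
      using that by (simp_all add: substructure_def AR_def)
    have "cnt \<alpha> = (\<lambda>i j. if j \<in> {1..K} then w j else 0)"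
      using a(2,4) by (intro ext) (auto simp: is_varray_def)
    moreover have "mark \<alpha> = (\<lambda>i. case i of Row1 \<Rightarrow> \<R> | Row2 \<Rightarrow> mark \<alpha> Row2)"
      using a(3) by (intro ext) (auto split: row.splits)
    ultimately have "\<alpha> = fst (array_of (mark \<alpha> Row2, pairing \<alpha>))"
      by (intro varray.equality) (simp_all add: array_of_def)
    then have "a = array_of (mark \<alpha> Row2, pairing \<alpha>)"
      unfolding a(1) by (simp add: array_of_def)
    then show ?thesis by blast
  qed
  show ?thesis
  proof (intro set_eqI iffI)
    fix a assume a: "a \<in> substructure K R1 R2 s w \<R> \<phi>"
    then obtain P \<sigma> where P\<sigma>: "a = array_of (P, \<sigma>)" using surj by blast
    then have "(P, \<sigma>) \<in> ?S" using a in_sub[of P \<sigma>] by simp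
    then show "a \<in> array_of ` ?S" using P\<sigma> by (rule rev_image_eqI)
  next
    fix a assume "a \<in> array_of ` ?S"
    then obtain x where x: "x \<in> ?S" "a = array_of x" by (rule imageE)
    then show "a \<in> substructure K R1 R2 s w \<R> \<phi>"
      using in_sub[of "fst x" "snd x"] by (simp only: prod.collapse)
  qed
qed

lemma card_substructure:
  "card (substructure K R1 R2 s w \<R> \<phi>) = (\<Sum>P | P \<subseteq> {1..K} \<and> card P = R2.
    card {\<sigma> \<in> matchings V V. acyclic (E2 P \<sigma>) \<and> acyclic (E1 \<sigma>)})"
proof -
  have "inj array_of"
  proof (rule injI)
    fix x y assume "array_of x = array_of y"
    then have "pairing (fst (array_of x)) = pairing (fst (array_of y))"
      "mark (fst (array_of x)) Row2 = mark (fst (array_of y)) Row2" by simp_all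
    then show "x = y" by (simp add: array_of_def prod_eq_iff split: prod.splits)
  qed
  then show ?thesis
    unfolding substructure_eq using finite_matchings[OF finite_V finite_V]
    by (simp add: card_image inj_on_subset)
qed

text \<open>With \<open>r = 0\<close> every vertex leads into \<open>C\<close>; as
  \<open>s \<ge> 1\<close>, \<open>C\<close> is nonempty, and no path from it can stop
  outside.\<close>

lemma substructure_empty:
  assumes "s \<ge> 1" "(\<Sum>j\<in>\<R>. w j) = 0"
  shows "substructure K R1 R2 s w \<R> \<phi> = {}"
proof -
  have "V \<noteq> {}" using card_V assms(1) by (metis card.empty not_one_le_zero)
  have A: "{v \<in> V. contract \<phi> (fst v) \<notin> C} = {}"
    using card_root_vertices assms(2) finite_V by simp
  then obtain c where c: "c \<in> C" using \<open>V \<noteq> {}\<close> by blast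
  have finC: "finite C" by (simp add: critical_cols_def)
  have "\<not> acyclic (E1 \<sigma>)" if "\<sigma> \<in> matchings V V" for \<sigma>
    using acyclic_step_imp_target_outside[OF finite_V finC c end_vertex_C that] A unfolding E1_def by blast
  then show ?thesis unfolding substructure_eq by blast
qed

lemma card_substructure_eq:
  assumes "R2 \<ge> 1" "(\<Sum>j\<in>\<R>. w j) > 0"
  shows "real (card (substructure K R1 R2 s w \<R> \<phi>)) = (\<Sum>j\<in>\<R>. w j) *
    (\<Sum>m\<le>card C. real ((K - m - 1) choose (R2 - 1)) * (fact (card C) / fact (card C - m)) * fact (s - m - 1))"
proof -
  interpret T: two_rows V F C end_vertex fst "contract \<phi>"
    using two_rows_columns[OF assms(2)] .
  have "card (substructure K R1 R2 s w \<R> \<phi>) = T.roots *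
      (\<Sum>m\<le>card C. ((K - m - 1) choose (R2 - 1)) * card (T.chains m) * fact (s - m - 1))"
  proof -
    have "F \<subseteq> {1..K}" by blast
    from T.sum_card_forest_matchings[OF finite_atLeastAtMost this assms(1)] show ?thesis
      unfolding card_substructure E1_def E2_def card_V by simp
  qed
  moreover have "T.roots = (\<Sum>j\<in>\<R>. w j)"
    unfolding T.roots_def by (rule card_root_vertices)
  ultimately show ?thesis by (simp add: T.card_chains)
qed

lemma critical_less: "card \<R> \<ge> 1 \<Longrightarrow> card C < K"
proof -
  assume "card \<R> \<ge> 1"
  then obtain j where "j \<in> \<R>" by (metis card.empty equals0I not_one_le_zero)
  then have "C \<subset> {1..K}" using dataD(2) by (auto simp: critical_cols_def)
  then show ?thesis using psubset_card_mono[of "{1..K}" C] by simp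
qed

end

section \<open>The closed formula\<close>

lemma binom_of_nat: "binom (int a) (int b) = a choose b"
  by (simp add: binom_def)

theorem theorem4p4:
  fixes K s R1 R2 :: nat
    and w :: "nat \<Rightarrow> nat"
    and \<R> :: "nat set"
    and \<phi> :: "nat \<rightharpoonup> nat"
    and r M :: nat
  assumes "K \<ge> 1" and "s \<ge> 1"
    and "1 \<le> R1" and "R1 \<le> K" and "1 \<le> R2" and "R2 \<le> K"
    and "substructure_data K R1 s w \<R> \<phi>"
    and "admissible_sub w \<R> \<phi>"
    and "r = (\<Sum>j\<in>\<R>. w j)"
    and "M = card (critical_cols K w \<R> \<phi>)"
  shows "real (card (substructure K R1 R2 s w \<R> \<phi>)) =
    fact s * (\<Sum>A=0..s-1. real r / (real s - real A)
      * real (binom (int M) (int M - int A))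
      * real (binom (int K - int M - 1) (int R2 - int M + int A - 1)))"
proof -
  interpret admissible_substructure K R1 s w \<R> \<phi>
    using assms(7,8) by unfold_locales
  show ?thesis
  \<comment> \<open>\<open>two_rows_columns\<close> requires \<open>r > 0\<close>; for
    \<open>r = 0\<close> both sides vanish.\<close>
  proof (cases "r = 0")
    case True
    then have "substructure K R1 R2 s w \<R> \<phi> = {}"
      using substructure_empty[OF assms(2)] assms(9) by simp
    then show ?thesis using True by simp
  next
    case False
    then have r: "(\<Sum>j\<in>\<R>. w j) > 0" using assms(9) by simp
    interpret T: two_rows V F C end_vertex fst "contract \<phi>"
      using two_rows_columns[OF r] .
    have Ms: "M < s" using T.few card_V assms(10) by simp
    have MK: "M < K" using critical_less assms(3,10) dataD(3) by simp
    define c where "c A = real (if M - A \<le> R2 - 1 then (K - M - 1) choose (R2 - 1 - (M - A)) else 0)" for A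
    have "real (card (substructure K R1 R2 s w \<R> \<phi>)) =
        r * (\<Sum>m\<le>M. real ((M - m + (K - M - 1)) choose (R2 - 1)) * (fact M / fact (M - m)) * fact (s - m - 1))"
    proof -
      \<comment> \<open>The upper index is split into the two parts to which Vandermonde's identity
        is applied.\<close>
      have "K - m - 1 = M - m + (K - M - 1)" if "m \<in> {..M}" for m using that MK by auto
      then have "(\<Sum>m\<le>M. real ((K - m - 1) choose (R2 - 1)) * (fact M / fact (M - m)) * fact (s - m - 1)) =
          (\<Sum>m\<le>M. real ((M - m + (K - M - 1)) choose (R2 - 1)) * (fact M / fact (M - m)) * (fact (s - m - 1) :: real))"
        by (intro sum.cong refl) presburger
      then show ?thesis using card_substructure_eq[OF assms(5) r] unfolding assms(9) assms(10)[symmetric] by simp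
    qed
    also have "\<dots> = r * (fact s * (\<Sum>A\<le>M. 1 / (real s - real A) * real (M choose A) * c A))"
      using sum_falling_binomial[OF Ms, of "K - M - 1" "R2 - 1"] by (simp add: c_def)
    also have "\<dots> = fact s * (\<Sum>A\<le>M. r / (real s - real A) * real (M choose A) * c A)"
      by (simp add: sum_distrib_left mult_ac)
    also have "(\<Sum>A\<le>M. r / (real s - real A) * real (M choose A) * c A) =
        (\<Sum>A=0..s-1. real r / (real s - real A) * real (binom (int M) (int M - int A))
          * real (binom (int K - int M - 1) (int R2 - int M + int A - 1)))"
    \<comment> \<open>Summands with \<open>A > M\<close> vanish because \<open>int M - int A\<close>
      is negative, and \<open>M < s\<close> keeps the shorter range inside the longer one.\<close>
    proof (rule sum.mono_neutral_cong_left)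
      show "\<forall>A\<in>{0..s - 1} - {..M}. real r / (real s - real A) * real (binom (int M) (int M - int A))
          * real (binom (int K - int M - 1) (int R2 - int M + int A - 1)) = 0"
        by (auto simp: binom_def)
      fix A assume "A \<in> {..M}"
      then have A: "A \<le> M" by simp
      then have "binom (int M) (int M - int A) = M choose A"
        using binomial_symmetric[OF A] by (simp add: binom_def nat_diff_distrib)
      moreover have "real (binom (int K - int M - 1) (int R2 - int M + int A - 1)) = c A"
      \<comment> \<open>The value 0 from the conditional in \<open>c\<close> corresponds to a
        negative lower index of \<open>binom\<close>.\<close>
      proof (cases "M - A \<le> R2 - 1")
        case True
        then have "int R2 - int M + int A - 1 = int (R2 - 1 - (M - A))"
          "int K - int M - 1 = int (K - M - 1)" using A assms(5) MK by auto
        then show ?thesis using True unfolding c_def by (simp only: binom_of_nat if_True)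
      next
        case False
        then have "int R2 - int M + int A - 1 < 0" using A assms(5) by linarith
        then show ?thesis using False by (simp add: binom_def c_def)
      qed
      ultimately show "real r / (real s - real A) * real (M choose A) * c A =
        real r / (real s - real A) * real (binom (int M) (int M - int A))
          * real (binom (int K - int M - 1) (int R2 - int M + int A - 1))" by simp
    qed (use Ms in auto)
    finally show ?thesis .
  qed
qed

end
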